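(* Let $X$ be a compact Riemann surface, $F$ a holomorphic vector bundle of finite rank on $X$ with a Hermitian metric, $E=\Pi(F\oplus F^\vee\otimes\omega_X)$, and $\mathcal C_E$ the chiral Clifford algebra. Let $U\subset X$ be a coordinate disc with coordinate $z$. For homogeneous $a\in(\mathcal C_E)^{|a|}_U$, $b\in(\mathcal C_E)^{|b|}_U$, the trace $\mathrm{tr}_\omega\circ\mathbf p\circ\mathcal W_{\mathrm{ch}}$ satisfies super-cyclicity: $$\mathrm{tr}_\omega\circ\mathbf p\circ\mathcal W_{\mathrm{ch}}(a\cdot b)=(-1)^{|a||b|}\,\mathrm{tr}_\omega\circ\mathbf p\circ\mathcal W_{\mathrm{ch}}(b\cdot a),$$ where $a\cdot b=(\tau^z_U)^{-1}\bigl(\tau^z_U(a)\wedge\tau^z_U(b)\bigr)$ denotes the local product.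
   Context: Conventions: complex-analytic category; everything $\mathbb Z/2\mathbb Z$-graded with the Koszul sign rule. $\omega_X$ canonical sheaf, $\Theta_X$ tangent sheaf, $\mathcal D_X$ differential operators, $\Delta$ the (big) diagonal, $( *\Delta)$ allows arbitrary poles along diagonals. $W=F\oplus F^\vee\otimes\omega_X$, $B((f,\varphi),(f',\varphi'))=\varphi(f')+\varphi'(f)$; $E=\Pi W$ is purely odd with symmetric pairing $\langle\Pi w,\Pi w'\rangle=B(w,w')\in\omega_X$. $L=E\otimes_{\mathcal O_X}\mathcal D_X$ with Lie$^*$ bracket $L\boxtimes L\to\Delta_*\omega_X$ induced by $\langle-,-\rangle$; $L^\flat=L\oplus\omega_X$; $\mathcal C_E=\mathcal U(L^\flat)/\langle1-1^\flat\rangle$, where $\mathcal U(L^\flat)$ is the Beilinson–Drinfeld chiral enveloping superalgebra (its fibre at $x$ is the vacuum module $\mathcal U(\Gamma(U\setminus x,h(L^\flat)))/\mathcal U\cdot\Gamma(U,h(L^\flat))$, with $h(M)=M/M\Theta_X$), $1$ its unit, $1^\flat=\omega_X\subset L^\flat$ the central copy. In a coordinate $z$ with frame $\{e_i\}$ of $E$, sections are spanned by $g\prod_{a=1}^k\frac{n_a!\,e_{i_a}}{(t-z)^{n_a+1}}|0\rangle$, of parity $k\bmod2$; $(\mathcal C_E)_U^{\bar0},(\mathcal C_E)_U^{\bar1}$ are the even and odd parts. $\tau^z_U:\mathcal C_E|_U\to\bigwedge^\bullet L|_U$ is the isomorphism sending $g\prod_{a=1}^k\frac{n_a!\,e_{i_a}}{(t-z)^{n_a+1}}|0\rangle$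 (times $dz$) to $g\,(e_{i_1}\otimes\partial_z^{n_1}\otimes dz^{-1})\wedge\cdots\wedge(e_{i_k}\otimes\partial_z^{n_k}\otimes dz^{-1})\cdot dz$, with $\bigwedge^0L=\omega_X$. Szegő kernel: $P$ is the kernel on $X^2$ with values in $E\boxtimes E$ of the Green's operator of $\bar\partial$ on the $L^2$-complement of the holomorphic sections $\mathbb H^0(X,E)$: $e(z_1)=\int_X\langle P(z_1,z_2),\bar\partial_{z_2}e(z_2)\rangle+\pi_{\mathbb H^0}(e)(z_1)$, $e\in\Omega^{0,0}(X,E)$; on a coordinate disc $P=P_{\mathrm{sing}}+Q_{\mathrm{reg}}$, $P_{\mathrm{sing}}=\frac{\mathrm{Id}\cdot dz}{z_1-z_2}$, $Q_{\mathrm{reg}}$ smooth. For a kernel $K$, $\partial_K$ of legs $a\otimes\partial^k\otimes dz^{-1}$, $b\otimes\partial^l\otimes dz^{-1}$ is $\partial_{z_1}^k\partial_{z_2}^lK$ paired with $a,b$; $e^K$ is the exponential of the contraction operator, i.e. the signed (Pfaffian) sum over all sets of disjoint pairs of legs ($\mathrm{pf}(K)(\psi_1\wedge\cdots\wedge\psi_{2m})=\frac1{2^mm!}\sum_{\sigma}\mathrm{sgn}(\sigma)\prod_s\partial_K(\psi_{\sigma(2s-1)},\psi_{\sigma(2s)})$). $e^{P_{\mathrm{sing}}}$ contracts only legs at different points, $e^{Q_{\mathrm{reg}}}$ also legs at the same point. $\mathcal W_{\mathrm{ch}}$ is locally $e^{P_{\mathrm{sing}}+Q_{\mathrm{reg}}}\circ(\tau^z_U)^{\boxtimes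 n}$; for a single point it is $e^{Q_{\mathrm{reg}}}\tau^z_U$. $\mathbf p$ is the projection $\bigwedge^\bullet L\to\bigwedge^0L=\omega_X$ and $\mathrm{tr}_\omega$ is the Beilinson–Drinfeld trace on the unit chiral algebra $\omega_X$ (iterated residue/integration map to $\mathbb C$). The identity is understood for sections (with Dolbeault form coefficients) to which $\mathrm{tr}_\omega$ can be applied. *)

theory Defs
  imports "HOL-Complex_Analysis.Complex_Analysis" "HOL-Combinatorics.Permutations"
begin

section \<open>Smooth functions and Wirtinger derivatives\<close>

text \<open>Only used on open sets \<open>S\<close>, hence \<open>at x\<close> rather than \<open>at x within S\<close>.\<close>

primrec Ck_on :: "nat \<Rightarrow> 'a::real_normed_vector set \<Rightarrow> ('a \<Rightarrow> complex) \<Rightarrow> bool" where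
  "Ck_on 0 S f \<longleftrightarrow> continuous_on S f"
| "Ck_on (Suc k) S f \<longleftrightarrow>
     (\<forall>x\<in>S. f differentiable (at x)) \<and> (\<forall>v. Ck_on k S (\<lambda>x. frechet_derivative f (at x) v))"

definition smooth_on :: "'a::real_normed_vector set \<Rightarrow> ('a \<Rightarrow> complex) \<Rightarrow> bool" where
  "smooth_on S f \<longleftrightarrow> (\<forall>k. Ck_on k S f)"

definition d_z :: "(complex \<Rightarrow> complex) \<Rightarrow> complex \<Rightarrow> complex" where
  "d_z f z = (frechet_derivative f (at z) 1 - \<i> * frechet_derivative f (at z) \<i>) / 2"

definition d_zbar :: "(complex \<Rightarrow> complex) \<Rightarrow> complex \<Rightarrow> complex" where
  "d_zbar f z = (frechet_derivative f (at z) 1 + \<i> * frechet_derivative f (at z) \<i>) / 2"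


section \<open>Compact Riemann surfaces with a holomorphic vector bundle\<close>

text \<open>
  A surface \<open>X\<close> with a bundle \<open>F\<close> is presented by a family of charts, each carrying a holomorphic
  frame of \<open>F\<close>, with the transition cocycle of the frames.  The presentation is
  arbitrary: any coordinate domain with a frame of \<open>F\<close> over it can be adjoined as a further
  index, so a statement about a coordinate disc \<open>U\<close> of \<open>X\<close> is a statement about an
  index whose chart has a disc as image.  Matrices are indexed by \<open>{0..<n}\<close>
  (the rank may be 0); entries outside that range are irrelevant.

  \<open>frame_trans X i j\<close> is the matrix with \<open>s_i = frame_trans X i j s_j\<close> for the component vectors
  of a section of \<open>F\<close> in the frames \<open>i\<close> and \<open>j\<close>.
\<close>

record ('i, 'x) framed_surface =
  chart_dom :: "'i \<Rightarrow> 'x set"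
  coord :: "'i \<Rightarrow> 'x \<Rightarrow> complex"
  bdl_rank :: nat
  frame_trans :: "'i \<Rightarrow> 'i \<Rightarrow> 'x \<Rightarrow> nat \<Rightarrow> nat \<Rightarrow> complex"

definition chart_img :: "('i, 'x) framed_surface \<Rightarrow> 'i \<Rightarrow> complex set" where
  "chart_img X i = coord X i ` chart_dom X i"

definition chart_pt :: "('i, 'x) framed_surface \<Rightarrow> 'i \<Rightarrow> complex \<Rightarrow> 'x" where
  "chart_pt X i = inv_into (chart_dom X i) (coord X i)"

definition compact_riemann_surface :: "('i, 'x::t2_space) framed_surface \<Rightarrow> bool" where
  "compact_riemann_surface X \<longleftrightarrow>
     compact (UNIV :: 'x set) \<and> connected (UNIV :: 'x set) \<and>
     (\<Union>i. chart_dom X i) = UNIV \<and>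
     (\<forall>i. open (chart_dom X i) \<and> open (chart_img X i) \<and>
          homeomorphism (chart_dom X i) (chart_img X i) (coord X i) (chart_pt X i)) \<and>
     (\<forall>i j. (coord X j \<circ> chart_pt X i) holomorphic_on coord X i ` (chart_dom X i \<inter> chart_dom X j))"

definition holomorphic_bundle :: "('i, 'x) framed_surface \<Rightarrow> bool" where
  "holomorphic_bundle X \<longleftrightarrow>
     (\<forall>i j. \<forall>a<bdl_rank X. \<forall>b<bdl_rank X.
        (\<lambda>u. frame_trans X i j (chart_pt X i u) a b)
          holomorphic_on coord X i ` (chart_dom X i \<inter> chart_dom X j)) \<and>
     (\<forall>i. \<forall>x\<in>chart_dom X i. \<forall>a<bdl_rank X. \<forall>b<bdl_rank X.
        frame_trans X i i x a b = (if a = b then 1 else 0)) \<and>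
     (\<forall>i j k. \<forall>x\<in>chart_dom X i \<inter> chart_dom X j \<inter> chart_dom X k.
        \<forall>a<bdl_rank X. \<forall>b<bdl_rank X.
        (\<Sum>c<bdl_rank X. frame_trans X i j x a c * frame_trans X j k x c b)
          = frame_trans X i k x a b)"

definition coordinate_disc :: "('i, 'x) framed_surface \<Rightarrow> 'i \<Rightarrow> bool" where
  "coordinate_disc X i \<longleftrightarrow> (\<exists>c \<rho>. 0 < \<rho> \<and> chart_img X i = ball c \<rho>)"

text \<open>The derivative \<open>d z_j / d z_i\<close> at \<open>x\<close>.\<close>

definition jac :: "('i, 'x) framed_surface \<Rightarrow> 'i \<Rightarrow> 'i \<Rightarrow> 'x \<Rightarrow> complex" where
  "jac X i j x = deriv (coord X j \<circ> chart_pt X i) (coord X i x)"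


section \<open>The bundle \<open>E\<close> and its pairing\<close>

text \<open>
  With \<open>r = bdl_rank X\<close> and \<open>(f_a)\<close> the frame of \<open>F\<close> of index \<open>i\<close>, \<open>E = \<Pi>(F \<oplus> F^\<or> \<otimes> \<omega>)\<close> has the frame
  \<open>e_a = \<Pi> f_a\<close>, \<open>e_(r+a) = \<Pi>(f^a \<otimes> dz_i)\<close> \<open>(a < r)\<close>, where \<open>(f^a)\<close> is the dual frame.  In it
  \<open>\<langle>e_a, e_b\<rangle> = eta r a b dz_i\<close>.  The matrix \<open>eta r\<close> is its own inverse.
\<close>

definition eta :: "nat \<Rightarrow> nat \<Rightarrow> nat \<Rightarrow> complex" where
  "eta r a b = (if b = a + r \<or> a = b + r then 1 else 0)"

definition E_trans :: "('i, 'x) framed_surface \<Rightarrow> 'i \<Rightarrow> 'i \<Rightarrow> 'x \<Rightarrow> nat \<Rightarrow> nat \<Rightarrow> complex" where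
  "E_trans X i j x a b = (let r = bdl_rank X in
     if a < r \<and> b < r then frame_trans X i j x a b
     else if r \<le> a \<and> r \<le> b then frame_trans X j i x (b - r) (a - r) * jac X i j x
     else 0)"

type_synonym ('i, 'x) E_field = "'i \<Rightarrow> 'x \<Rightarrow> nat \<Rightarrow> complex"

definition E_smooth_sections :: "('i, 'x) framed_surface \<Rightarrow> ('i, 'x) E_field set" where
  "E_smooth_sections X = {e.
     (\<forall>i j. \<forall>x\<in>chart_dom X i \<inter> chart_dom X j. \<forall>a<2 * bdl_rank X.
        e i x a = (\<Sum>b<2 * bdl_rank X. E_trans X i j x a b * e j x b)) \<and>
     (\<forall>i. \<forall>a<2 * bdl_rank X. smooth_on (chart_img X i) (\<lambda>u. e i (chart_pt X i u) a))}"

definition E_holomorphic_sections :: "('i, 'x) framed_surface \<Rightarrow> ('i, 'x) E_field set" where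
  "E_holomorphic_sections X = {e \<in> E_smooth_sections X.
     \<forall>i. \<forall>a<2 * bdl_rank X. (\<lambda>u. e i (chart_pt X i u) a) holomorphic_on chart_img X i}"

text \<open>\<open>E\<close>-valued (0,1)-forms, given by their coefficients of \<open>d(zbar_i)\<close>.\<close>

definition E_01_forms :: "('i, 'x) framed_surface \<Rightarrow> ('i, 'x) E_field set" where
  "E_01_forms X = {\<alpha>.
     (\<forall>i j. \<forall>x\<in>chart_dom X i \<inter> chart_dom X j. \<forall>a<2 * bdl_rank X.
        \<alpha> i x a = (\<Sum>b<2 * bdl_rank X. E_trans X i j x a b * \<alpha> j x b) * cnj (jac X i j x)) \<and>
     (\<forall>i. \<forall>a<2 * bdl_rank X. smooth_on (chart_img X i) (\<lambda>u. \<alpha> i (chart_pt X i u) a))}"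

definition dbar :: "('i, 'x) framed_surface \<Rightarrow> ('i, 'x) E_field \<Rightarrow> ('i, 'x) E_field" where
  "dbar X e = (\<lambda>i x a. d_zbar (\<lambda>u. e i (chart_pt X i u) a) (coord X i x))"


section \<open>Integration over the surface\<close>

text \<open>
  A (1,1)-form is a family \<open>\<mu>\<close> with \<open>\<mu> i\<close> its coefficient of \<open>d(zbar_i) \<and> d(z_i)\<close>.  Integrals are
  normalised by \<open>1/(2 pi i)\<close>, so that \<open>d(zbar) \<and> d(z) = 2 i dA\<close> contributes \<open>dA / pi\<close>; this is the
  normalisation under which the kernel \<open>1/(z_1 - z_2)\<close> inverts \<open>dbar\<close> (Cauchy-Pompeiu).
  The surface is cut into finitely many disjoint Borel pieces lying in charts; for an honest
  integrable (1,1)-form on a compact surface the result does not depend on the cover chosen.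
\<close>

definition surface_integral ::
    "('i, 'x) framed_surface \<Rightarrow> ('i \<Rightarrow> 'x \<Rightarrow> complex) \<Rightarrow> complex" where
  "surface_integral X \<mu> =
     (let js = (SOME js. (\<Union>j\<in>set js. chart_dom X j) = UNIV) in
        \<Sum>k<length js. (1 / of_real pi) *
          set_lebesgue_integral lborel
            (coord X (js ! k) ` (chart_dom X (js ! k) - (\<Union>l<k. chart_dom X (js ! l))))
            (\<lambda>u. \<mu> (js ! k) (chart_pt X (js ! k) u)))"


section \<open>Hermitian structures and the Szego kernel\<close>

text \<open>\<open>h i x a b\<close> is the inner product of \<open>f_a\<close> and \<open>f_b\<close> (conjugate-linear in the second slot).\<close>

definition hermitian_metric ::
    "('i, 'x) framed_surface \<Rightarrow> ('i \<Rightarrow> 'x \<Rightarrow> nat \<Rightarrow> nat \<Rightarrow> complex) \<Rightarrow> bool" where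
  "hermitian_metric X h \<longleftrightarrow>
     (\<forall>i. \<forall>a<bdl_rank X. \<forall>b<bdl_rank X.
        smooth_on (chart_img X i) (\<lambda>u. h i (chart_pt X i u) a b)) \<and>
     (\<forall>i. \<forall>x\<in>chart_dom X i. \<forall>a<bdl_rank X. \<forall>b<bdl_rank X. h i x b a = cnj (h i x a b)) \<and>
     (\<forall>i. \<forall>x\<in>chart_dom X i. \<forall>v. (\<exists>a<bdl_rank X. v a \<noteq> 0) \<longrightarrow>
        0 < Re (\<Sum>a<bdl_rank X. \<Sum>b<bdl_rank X. h i x a b * v a * cnj (v b))) \<and>
     (\<forall>i j. \<forall>x\<in>chart_dom X i \<inter> chart_dom X j. \<forall>a<bdl_rank X. \<forall>b<bdl_rank X.
        h j x a b = (\<Sum>c<bdl_rank X. \<Sum>d<bdl_rank X.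
          h i x c d * frame_trans X i j x c a * cnj (frame_trans X i j x d b)))"

text \<open>
  The \<open>L^2\<close> product on sections of \<open>F\<close> needs a volume form on \<open>X\<close>, equivalently a Hermitian metric
  on \<open>X\<close>: \<open>\<nu> i\<close> is its positive density with respect to \<open>dA\<close> in the coordinate \<open>z_i\<close>.
\<close>

definition surface_metric :: "('i, 'x) framed_surface \<Rightarrow> ('i \<Rightarrow> 'x \<Rightarrow> real) \<Rightarrow> bool" where
  "surface_metric X \<nu> \<longleftrightarrow>
     (\<forall>i. smooth_on (chart_img X i) (\<lambda>u. complex_of_real (\<nu> i (chart_pt X i u)))) \<and>
     (\<forall>i. \<forall>x\<in>chart_dom X i. 0 < \<nu> i x) \<and>
     (\<forall>i j. \<forall>x\<in>chart_dom X i \<inter> chart_dom X j. \<nu> i x = \<nu> j x * (cmod (jac X i j x))\<^sup>2)"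

definition mat_inverse :: "nat \<Rightarrow> (nat \<Rightarrow> nat \<Rightarrow> complex) \<Rightarrow> nat \<Rightarrow> nat \<Rightarrow> complex" where
  "mat_inverse r M = (SOME N. \<forall>a<r. \<forall>b<r. (\<Sum>c<r. M a c * N c b) = (if a = b then 1 else 0))"

text \<open>
  Integrand of the \<open>L^2\<close> product of sections of \<open>E\<close>, for \<open>h\<close> on \<open>F\<close>, the dual metric on \<open>F^\<or>\<close>
  and the metric \<open>\<nu>\<close> on \<open>X\<close>.  On \<open>F^\<or> \<otimes> \<omega>\<close> the norm of \<open>dz_i\<close> and the volume density cancel.
  For (0,1)-forms there is one more factor \<open>|d(zbar_i)|^2 = 1 / \<nu> i\<close> (constants are immaterial for
  orthogonality).
\<close>

definition E_density ::
    "('i, 'x) framed_surface \<Rightarrow> ('i \<Rightarrow> 'x \<Rightarrow> nat \<Rightarrow> nat \<Rightarrow> complex) \<Rightarrow> ('i \<Rightarrow> 'x \<Rightarrow> real) \<Rightarrow>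
     ('i, 'x) E_field \<Rightarrow> ('i, 'x) E_field \<Rightarrow> 'i \<Rightarrow> 'x \<Rightarrow> complex" where
  "E_density X h \<nu> e e' i x = (let r = bdl_rank X; H = mat_inverse r (h i x) in
     of_real (\<nu> i x) * (\<Sum>a<r. \<Sum>b<r. h i x a b * e i x a * cnj (e' i x b))
     + (\<Sum>a<r. \<Sum>b<r. H b a * e i x (r + a) * cnj (e' i x (r + b))))"

definition E_L2 where
  "E_L2 X h \<nu> e e' = surface_integral X (E_density X h \<nu> e e')"

definition E_L2_01 where
  "E_L2_01 X h \<nu> \<alpha> \<beta> =
     surface_integral X (\<lambda>i x. E_density X h \<nu> \<alpha> \<beta> i x / of_real (\<nu> i x))"

text \<open>\<open>P i j x y a b\<close> is the component of a section of \<open>E \<boxtimes> E\<close> at \<open>(x, y)\<close> in the frames \<open>i\<close>, \<open>j\<close>.\<close>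

type_synonym ('i, 'x) E_kernel = "'i \<Rightarrow> 'i \<Rightarrow> 'x \<Rightarrow> 'x \<Rightarrow> nat \<Rightarrow> nat \<Rightarrow> complex"

text \<open>\<open>z_1 \<mapsto> \<integral> \<langle>P(z_1, z_2), \<alpha>(z_2)\<rangle>\<close>, for a (0,1)-form \<open>\<alpha>\<close>.\<close>

definition kernel_apply ::
    "('i, 'x) framed_surface \<Rightarrow> ('i, 'x) E_kernel \<Rightarrow> ('i, 'x) E_field \<Rightarrow> ('i, 'x) E_field" where
  "kernel_apply X P \<alpha> = (\<lambda>i x a. surface_integral X (\<lambda>j y.
     \<Sum>b<2 * bdl_rank X. \<Sum>b'<2 * bdl_rank X.
       P i j x y a b * eta (bdl_rank X) b b' * \<alpha> j y b'))"

text \<open>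
  \<open>Q\<close> is the smooth part of \<open>P\<close> on \<open>U_i \<times> U_i\<close> in the coordinate \<open>z_i\<close>:
  \<open>P = Id dz / (z_1 - z_2) + Q\<close>, where \<open>Id dz\<close> has components \<open>eta\<close> under \<open>E^\<or> \<otimes> \<omega> = E\<close>.
\<close>

definition regular_part ::
    "('i, 'x) framed_surface \<Rightarrow> ('i, 'x) E_kernel \<Rightarrow> 'i \<Rightarrow>
     (complex \<Rightarrow> complex \<Rightarrow> nat \<Rightarrow> nat \<Rightarrow> complex) \<Rightarrow> bool" where
  "regular_part X P i Q \<longleftrightarrow>
     (\<forall>a<2 * bdl_rank X. \<forall>b<2 * bdl_rank X.
        smooth_on (chart_img X i \<times> chart_img X i) (\<lambda>(u, v). Q u v a b)) \<and>
     (\<forall>x\<in>chart_dom X i. \<forall>y\<in>chart_dom X i. x \<noteq> y \<longrightarrow>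
        (\<forall>a<2 * bdl_rank X. \<forall>b<2 * bdl_rank X.
           P i i x y a b = eta (bdl_rank X) a b / (coord X i x - coord X i y)
                           + Q (coord X i x) (coord X i y) a b))"

definition Q_reg ::
    "('i, 'x) framed_surface \<Rightarrow> ('i, 'x) E_kernel \<Rightarrow> 'i \<Rightarrow>
     complex \<Rightarrow> complex \<Rightarrow> nat \<Rightarrow> nat \<Rightarrow> complex" where
  "Q_reg X P i = (SOME Q. regular_part X P i Q)"

text \<open>
  The kernel of the Green's operator \<open>G\<close>: a section of \<open>E \<boxtimes> E\<close> off the diagonal with the
  singularity above, such that \<open>e = G(dbar e) + \<pi>(e)\<close> with \<open>\<pi>\<close> the \<open>L^2\<close>-orthogonal projection to the
  holomorphic sections, and (as usual for Green's operators) \<open>G = 0\<close> on the orthogonal complement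
  of the image of \<open>dbar\<close>.
\<close>

definition szego_kernel ::
    "('i, 'x) framed_surface \<Rightarrow> ('i \<Rightarrow> 'x \<Rightarrow> nat \<Rightarrow> nat \<Rightarrow> complex) \<Rightarrow> ('i \<Rightarrow> 'x \<Rightarrow> real) \<Rightarrow>
     ('i, 'x) E_kernel \<Rightarrow> bool" where
  "szego_kernel X h \<nu> P \<longleftrightarrow>
     (\<forall>i i' j j'. \<forall>x\<in>chart_dom X i \<inter> chart_dom X i'. \<forall>y\<in>chart_dom X j \<inter> chart_dom X j'.
        x \<noteq> y \<longrightarrow> (\<forall>a<2 * bdl_rank X. \<forall>b<2 * bdl_rank X.
          P i j x y a b = (\<Sum>c<2 * bdl_rank X. \<Sum>d<2 * bdl_rank X.
             E_trans X i i' x a c * E_trans X j j' y b d * P i' j' x y c d))) \<and>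
     (\<forall>i j. \<forall>a<2 * bdl_rank X. \<forall>b<2 * bdl_rank X.
        smooth_on {(u, v). u \<in> chart_img X i \<and> v \<in> chart_img X j \<and> chart_pt X i u \<noteq> chart_pt X j v}
          (\<lambda>(u, v). P i j (chart_pt X i u) (chart_pt X j v) a b)) \<and>
     (\<forall>i. \<exists>Q. regular_part X P i Q) \<and>
     (\<forall>e\<in>E_smooth_sections X. \<forall>p\<in>E_holomorphic_sections X.
        (\<forall>q\<in>E_holomorphic_sections X. E_L2 X h \<nu> (\<lambda>i x a. e i x a - p i x a) q = 0) \<longrightarrow>
        (\<forall>i. \<forall>x\<in>chart_dom X i. \<forall>a<2 * bdl_rank X.
           e i x a = kernel_apply X P (dbar X e) i x a + p i x a)) \<and>
     (\<forall>\<alpha>\<in>E_01_forms X.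
        (\<forall>e\<in>E_smooth_sections X. E_L2_01 X h \<nu> \<alpha> (dbar X e) = 0) \<longrightarrow>
        (\<forall>i. \<forall>x\<in>chart_dom X i. \<forall>a<2 * bdl_rank X. kernel_apply X P \<alpha> i x a = 0))"


section \<open>The chiral Clifford algebra on a coordinate disc\<close>

text \<open>
  Everything here is in the coordinate \<open>t\<close> on \<open>D = z(U)\<close> and the frame \<open>(e_a)\<close> of \<open>E\<close>.
  For \<open>L = E \<otimes> \<D>\<close> one has \<open>h(L) = L / L \<Theta> = E\<close>, and \<open>h(\<omega>) = \<omega> / d \<O>\<close>.  So
  \<open>h(L^\<flat>)\<close> over \<open>U\<close> minus \<open>x\<close>, with poles of arbitrary finite order at \<open>x\<close>, is spanned by
  \<open>EPart s\<close> (odd) and \<open>OmPart w\<close>, representing the class of \<open>w dt\<close> (even), subject to linearity and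
  \<open>OmPart f' = 0\<close>.  The Lie superbracket is \<open>[EPart s, EPart s'] = OmPart \<langle>s, s'\<rangle>\<close>, with
  \<open>OmPart\<close> central.
\<close>

datatype hL_flat = EPart "complex \<Rightarrow> nat \<Rightarrow> complex" | OmPart "complex \<Rightarrow> complex"

definition merom_at :: "complex set \<Rightarrow> complex \<Rightarrow> (complex \<Rightarrow> complex) \<Rightarrow> bool" where
  "merom_at D x f \<longleftrightarrow>
     (\<exists>m g. g holomorphic_on D \<and> (\<forall>t\<in>D - {x}. f t = g t / (t - x) ^ m))"

definition hL_sections :: "nat \<Rightarrow> complex set \<Rightarrow> complex \<Rightarrow> hL_flat set" where
  "hL_sections r D x =
     {EPart s | s. \<forall>a<2 * r. merom_at D x (\<lambda>t. s t a)} \<union> {OmPart w | w. merom_at D x w}"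

text \<open>
  Elements of the free algebra on \<open>hL_sections\<close> are finitely supported functions on words.
  \<open>vac_rels r D x\<close> is the subspace by which it is divided to obtain the fibre of
  \<open>\<C>_E = \<U>(L^\<flat>) / \<langle>1 - 1^\<flat>\<rangle>\<close> at \<open>x\<close>: relations of the Lie superalgebra and of its universal
  enveloping algebra, the left ideal generated by the sections regular on all of \<open>D\<close>, and
  \<open>1^\<flat> = 1\<close>, where \<open>1^\<flat>\<close> in the fibre is the class of \<open>OmPart (1/(t - x))\<close>.
  Clauses \<open>E_lin\<close> and \<open>Om_lin\<close> also identify sections that agree on \<open>D - {x}\<close>.
\<close>

type_synonym free_alg = "hL_flat list \<Rightarrow> complex"

definition word :: "hL_flat list \<Rightarrow> free_alg" where
  "word v = (\<lambda>u. if u = v then 1 else 0)"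

inductive_set vac_rels :: "nat \<Rightarrow> complex set \<Rightarrow> complex \<Rightarrow> free_alg set"
  for r :: nat and D :: "complex set" and x :: complex where
  E_lin: "\<lbrakk>set u \<union> set v \<union> {EPart s, EPart s', EPart s''} \<subseteq> hL_sections r D x;
           \<forall>t\<in>D - {x}. \<forall>a<2 * r. s'' t a = c * s t a + s' t a\<rbrakk> \<Longrightarrow>
    (\<lambda>y. word (u @ [EPart s''] @ v) y - c * word (u @ [EPart s] @ v) y - word (u @ [EPart s'] @ v) y)
      \<in> vac_rels r D x"
| Om_lin: "\<lbrakk>set u \<union> set v \<union> {OmPart w, OmPart w', OmPart w''} \<subseteq> hL_sections r D x;
            \<forall>t\<in>D - {x}. w'' t = c * w t + w' t\<rbrakk> \<Longrightarrow>
    (\<lambda>y. word (u @ [OmPart w''] @ v) y - c * word (u @ [OmPart w] @ v) y - word (u @ [OmPart w'] @ v) y)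
      \<in> vac_rels r D x"
| exact: "\<lbrakk>set u \<union> set v \<subseteq> hL_sections r D x; merom_at D x f\<rbrakk> \<Longrightarrow>
    word (u @ [OmPart (deriv f)] @ v) \<in> vac_rels r D x"
| bracket: "set u \<union> set v \<union> {EPart s, EPart s'} \<subseteq> hL_sections r D x \<Longrightarrow>
    (\<lambda>y. word (u @ [EPart s, EPart s'] @ v) y + word (u @ [EPart s', EPart s] @ v) y
         - word (u @ [OmPart (\<lambda>t. \<Sum>a<2 * r. \<Sum>b<2 * r. eta r a b * s t a * s' t b)] @ v) y)
      \<in> vac_rels r D x"
| central: "set u \<union> set v \<union> {OmPart w, l} \<subseteq> hL_sections r D x \<Longrightarrow>
    (\<lambda>y. word (u @ [OmPart w, l] @ v) y - word (u @ [l, OmPart w] @ v) y) \<in> vac_rels r D x"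
| unit: "set u \<union> set v \<subseteq> hL_sections r D x \<Longrightarrow>
    (\<lambda>y. word (u @ [OmPart (\<lambda>t. 1 / (t - x))] @ v) y - word (u @ v) y) \<in> vac_rels r D x"
| vacuum_E: "\<lbrakk>set u \<subseteq> hL_sections r D x; \<forall>a<2 * r. (\<lambda>t. s t a) holomorphic_on D\<rbrakk> \<Longrightarrow>
    word (u @ [EPart s]) \<in> vac_rels r D x"
| vacuum_Om: "\<lbrakk>set u \<subseteq> hL_sections r D x; w holomorphic_on D\<rbrakk> \<Longrightarrow>
    word (u @ [OmPart w]) \<in> vac_rels r D x"
| add: "\<lbrakk>A \<in> vac_rels r D x; B \<in> vac_rels r D x\<rbrakk> \<Longrightarrow> (\<lambda>y. A y + B y) \<in> vac_rels r D x"
| scale: "A \<in> vac_rels r D x \<Longrightarrow> (\<lambda>y. c * A y) \<in> vac_rels r D x"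

text \<open>
  Sections of \<open>\<C>_E\<close> over \<open>U\<close> with Dolbeault coefficients are functions \<open>q x\<close> \<open>\<mapsto>\<close> element of the
  fibre at \<open>x\<close>, for \<open>q = 0, 1\<close> the coefficient of \<open>d(zbar)^q\<close>; the factor \<open>dz\<close> is suppressed.
  \<open>cl_class\<close> passes from representatives in the free algebras to cosets.
\<close>

type_synonym cl_rep = "nat \<Rightarrow> complex \<Rightarrow> free_alg"
type_synonym cl_section = "nat \<Rightarrow> complex \<Rightarrow> free_alg set"

definition cl_class :: "nat \<Rightarrow> complex set \<Rightarrow> cl_rep \<Rightarrow> cl_section" where
  "cl_class r D A = (\<lambda>q x. if x \<in> D
     then {B. (\<lambda>y. B y - A q x y) \<in> vac_rels r D x} else {})"

text \<open>A leg \<open>(a, n)\<close> stands for \<open>e_a \<otimes> \<partial>^n \<otimes> dz^(-1)\<close>, and for the section \<open>n! e_a / (t - x)^(n+1)\<close>.\<close>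

type_synonym leg = "nat \<times> nat"

definition creation :: "complex \<Rightarrow> leg \<Rightarrow> hL_flat" where
  "creation x l = EPart (\<lambda>t b. if b = fst l then fact (snd l) / (t - x) ^ (snd l + 1) else 0)"

text \<open>\<open>g d(zbar)^q\<close> times the product of the legs \<open>ls\<close> applied to the vacuum.\<close>

definition cl_term :: "leg list \<Rightarrow> nat \<Rightarrow> (complex \<Rightarrow> complex) \<Rightarrow> cl_rep" where
  "cl_term ls q g = (\<lambda>p x y. if p = q then g x * word (map (creation x) ls) y else 0)"

text \<open>
  The span of the terms whose parity lies in \<open>I\<close>; with Koszul signs \<open>d(zbar)\<close> is odd, so the parity
  is that of the number of legs plus the form degree of the coefficient.
\<close>

inductive_set cl_reps :: "nat \<Rightarrow> complex set \<Rightarrow> nat set \<Rightarrow> cl_rep set"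
  for r :: nat and D :: "complex set" and I :: "nat set" where
  "\<lbrakk>smooth_on D g; q \<le> 1; \<forall>l\<in>set ls. fst l < 2 * r; (q + length ls) mod 2 \<in> I\<rbrakk> \<Longrightarrow>
    cl_term ls q g \<in> cl_reps r D I"
| "\<lbrakk>A \<in> cl_reps r D I; B \<in> cl_reps r D I\<rbrakk> \<Longrightarrow> (\<lambda>q x y. A q x y + B q x y) \<in> cl_reps r D I"

definition chiral_clifford :: "('i, 'x) framed_surface \<Rightarrow> 'i \<Rightarrow> cl_section set" where
  "chiral_clifford X i =
     cl_class (bdl_rank X) (chart_img X i) ` cl_reps (bdl_rank X) (chart_img X i) {0, 1}"

text \<open>Homogeneous sections of parity \<open>\<epsilon>\<close> (0 or 1).\<close>

definition chiral_clifford_hom :: "('i, 'x) framed_surface \<Rightarrow> 'i \<Rightarrow> nat \<Rightarrow> cl_section set" where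
  "chiral_clifford_hom X i \<epsilon> =
     cl_class (bdl_rank X) (chart_img X i) ` cl_reps (bdl_rank X) (chart_img X i) {\<epsilon>}"


section \<open>The exterior algebra of \<open>L\<close> and the isomorphism \<open>\<tau>\<close>\<close>

text \<open>
  A section of \<open>\<And>L\<close> over \<open>U\<close> with Dolbeault coefficients is given by its coordinates in the
  basis \<open>d(zbar)^q e_S dz\<close>: \<open>S\<close> is a finite set of legs and \<open>e_S\<close> the wedge product of its elements
  in increasing lexicographic order.
\<close>

type_synonym ext_section = "nat \<Rightarrow> leg set \<Rightarrow> complex \<Rightarrow> complex"

definition leg_less :: "leg \<Rightarrow> leg \<Rightarrow> bool" where
  "leg_less l l' \<longleftrightarrow> fst l < fst l' \<or> fst l = fst l' \<and> snd l < snd l'"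

definition leg_list :: "leg set \<Rightarrow> leg list" where
  "leg_list S = (THE ls. set ls = S \<and> sorted_wrt leg_less ls)"

text \<open>Coordinates of \<open>l_1 \<and> ... \<and> l_k\<close>; the sign counts inversions.\<close>

definition wedge_legs :: "leg list \<Rightarrow> leg set \<Rightarrow> complex" where
  "wedge_legs ls S = (if distinct ls \<and> S = set ls
     then (-1) ^ card {(i, j). i < j \<and> j < length ls \<and> leg_less (ls ! j) (ls ! i)} else 0)"

text \<open>For disjoint \<open>A\<close>, \<open>B\<close>: \<open>e_A \<and> e_B = shuffle_sign A B e_(A \<union> B)\<close>.\<close>

definition shuffle_sign :: "leg set \<Rightarrow> leg set \<Rightarrow> complex" where
  "shuffle_sign A B = (-1) ^ card {(l, l'). l \<in> A \<and> l' \<in> B \<and> leg_less l' l}"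

text \<open>The factor \<open>(-1)^(|A| (n-p))\<close> is the Koszul sign from moving \<open>d(zbar)^(n-p)\<close> past \<open>e_A\<close>.\<close>

definition ext_wedge :: "ext_section \<Rightarrow> ext_section \<Rightarrow> ext_section" where
  "ext_wedge w w' = (\<lambda>n S x. if n \<le> 1 then
     (\<Sum>p\<le>n. \<Sum>A\<in>Pow S. (-1) ^ (card A * (n - p)) * shuffle_sign A (S - A)
        * w p A x * w' (n - p) (S - A) x) else 0)"

definition ext_term ::
    "complex set \<Rightarrow> leg list \<Rightarrow> nat \<Rightarrow> (complex \<Rightarrow> complex) \<Rightarrow> ext_section" where
  "ext_term D ls q g = (\<lambda>p S x. if p = q \<and> x \<in> D then g x * wedge_legs ls S else 0)"

inductive tau_graph :: "nat \<Rightarrow> complex set \<Rightarrow> cl_rep \<Rightarrow> ext_section \<Rightarrow> bool"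
  for r :: nat and D :: "complex set" where
  "\<lbrakk>smooth_on D g; q \<le> 1; \<forall>l\<in>set ls. fst l < 2 * r\<rbrakk> \<Longrightarrow>
    tau_graph r D (cl_term ls q g) (ext_term D ls q g)"
| "\<lbrakk>tau_graph r D A w; tau_graph r D B w'\<rbrakk> \<Longrightarrow>
    tau_graph r D (\<lambda>q x y. A q x y + B q x y) (\<lambda>q S x. w q S x + w' q S x)"

definition tau :: "('i, 'x) framed_surface \<Rightarrow> 'i \<Rightarrow> cl_section \<Rightarrow> ext_section" where
  "tau X i a = (THE w. \<exists>A. tau_graph (bdl_rank X) (chart_img X i) A w
                        \<and> a = cl_class (bdl_rank X) (chart_img X i) A)"

definition local_product ::
    "('i, 'x) framed_surface \<Rightarrow> 'i \<Rightarrow> cl_section \<Rightarrow> cl_section \<Rightarrow> cl_section" where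
  "local_product X i a b =
     inv_into (chiral_clifford X i) (tau X i) (ext_wedge (tau X i a) (tau X i b))"


section \<open>The operator \<open>W_ch\<close> and the trace\<close>

text \<open>\<open>\<partial>_K\<close> of two legs at the same point \<open>x\<close>.\<close>

definition contract_legs ::
    "nat \<Rightarrow> (complex \<Rightarrow> complex \<Rightarrow> nat \<Rightarrow> nat \<Rightarrow> complex) \<Rightarrow> complex \<Rightarrow> leg \<Rightarrow> leg \<Rightarrow> complex" where
  "contract_legs r K x l l' = (\<Sum>c<2 * r. \<Sum>d<2 * r. eta r c (fst l) * eta r d (fst l') *
     (d_z ^^ snd l) (\<lambda>u. (d_z ^^ snd l') (\<lambda>v. K u v c d) x) x)"

definition pfaffian ::
    "nat \<Rightarrow> (complex \<Rightarrow> complex \<Rightarrow> nat \<Rightarrow> nat \<Rightarrow> complex) \<Rightarrow> complex \<Rightarrow> leg list \<Rightarrow> complex" where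
  "pfaffian r K x ls = (let m = length ls div 2 in
     if even (length ls)
     then (1 / (2 ^ m * fact m)) * (\<Sum>\<sigma> | \<sigma> permutes {..<2 * m}. of_int (sign \<sigma>) *
            (\<Prod>s<m. contract_legs r K x (ls ! \<sigma> (2 * s)) (ls ! \<sigma> (2 * s + 1))))
     else 0)"

text \<open>
  \<open>e^K\<close>: the coefficient of \<open>e_R\<close> collects from every \<open>e_S\<close> with \<open>R \<subseteq> S\<close> the contraction of all legs
  in \<open>S - R\<close>.
\<close>

definition exp_contraction ::
    "nat \<Rightarrow> (complex \<Rightarrow> complex \<Rightarrow> nat \<Rightarrow> nat \<Rightarrow> complex) \<Rightarrow> ext_section \<Rightarrow> ext_section" where
  "exp_contraction r K w = (\<lambda>q R x. \<Sum>S | R \<subseteq> S \<and> w q S x \<noteq> 0.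
     shuffle_sign (S - R) R * pfaffian r K x (leg_list (S - R)) * w q S x)"

definition W_ch ::
    "('i, 'x) framed_surface \<Rightarrow> ('i, 'x) E_kernel \<Rightarrow> 'i \<Rightarrow> cl_section \<Rightarrow> ext_section" where
  "W_ch X P i a = exp_contraction (bdl_rank X) (Q_reg X P i) (tau X i a)"

text \<open>\<open>proj_omega w q\<close> is the coefficient of \<open>d(zbar)^q dz\<close>.\<close>

definition proj_omega :: "ext_section \<Rightarrow> nat \<Rightarrow> complex \<Rightarrow> complex" where
  "proj_omega w = (\<lambda>q x. w q {} x)"

text \<open>
  On \<open>\<omega>\<close> over one point the trace is integration over \<open>X\<close> of the (1,1)-component.  A form on \<open>U_i\<close> is
  extended by zero, which is legitimate for forms compactly supported in \<open>U_i\<close>.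
\<close>

definition tr_omega ::
    "('i, 'x) framed_surface \<Rightarrow> 'i \<Rightarrow> (nat \<Rightarrow> complex \<Rightarrow> complex) \<Rightarrow> complex" where
  "tr_omega X i f = surface_integral X (\<lambda>j y. if y \<in> chart_dom X i \<inter> chart_dom X j
     then f 1 (coord X i y) * of_real ((cmod (jac X j i y))\<^sup>2) else 0)"

definition tr_applicable ::
    "('i, 'x) framed_surface \<Rightarrow> 'i \<Rightarrow> (nat \<Rightarrow> complex \<Rightarrow> complex) \<Rightarrow> bool" where
  "tr_applicable X i f \<longleftrightarrow> (\<exists>K. compact K \<and> K \<subseteq> chart_img X i \<and>
     (\<forall>q. \<forall>x\<in>chart_img X i - K. f q x = 0))"

end

theory Submission
  imports Defs
begin

text \<open>
  The operator \<open>W_ch\<close>, the projection and the trace are linear and depend on \<open>a \<cdot> b\<close> only through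
  \<open>\<tau> (a \<cdot> b)\<close>, so everything reduces to the supercommutativity of the exterior algebra, provided
  that \<open>\<tau>\<close> is well defined and its image is closed under the wedge product.  Well-definedness is
  the linear independence of the monomials in the creation operators: the free algebra acts on the
  Fock space \<open>\<And>L\<close>, a meromorphic section of \<open>E\<close> acting by exterior multiplication with its
  polar part plus contraction with its regular part, and a 1-form by its residue.  The matrix
  coefficients with the vacuum vanish on all relations, and on a monomial in the creation operators
  they are the coordinates of the wedge product of its legs.
\<close>

section \<open>Signs in the exterior algebra\<close>

lemma leg_less_irrefl [simp]: "\<not> leg_less l l"
  by (simp add: leg_less_def)

lemma leg_less_total: "l \<noteq> l' \<Longrightarrow> leg_less l l' \<longleftrightarrow> \<not> leg_less l' l"
  by (cases l; cases l') (auto simp: leg_less_def)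

lemma shuffle_sign_Un_left:
  assumes "finite A" "finite A'" "finite B" "A \<inter> A' = {}"
  shows "shuffle_sign (A \<union> A') B = shuffle_sign A B * shuffle_sign A' B"
proof -
  let ?I = "\<lambda>A. {(l, l'). l \<in> A \<and> l' \<in> B \<and> leg_less l' l}"
  have fin: "finite (?I A)" "finite (?I A')"
    by (rule finite_subset[of _ "A \<times> B"], use assms in auto)
       (rule finite_subset[of _ "A' \<times> B"], use assms in auto)
  have "?I (A \<union> A') = ?I A \<union> ?I A'" by auto
  moreover have "?I A \<inter> ?I A' = {}" using assms(4) by auto
  ultimately have "card (?I (A \<union> A')) = card (?I A) + card (?I A')"
    using fin by (simp add: card_Un_disjoint)
  then show ?thesis
    by (simp add: shuffle_sign_def power_add)
qed

lemma shuffle_sign_Un_right: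
  assumes "finite A" "finite B" "finite B'" "B \<inter> B' = {}"
  shows "shuffle_sign A (B \<union> B') = shuffle_sign A B * shuffle_sign A B'"
proof -
  let ?I = "\<lambda>B. {(l, l'). l \<in> A \<and> l' \<in> B \<and> leg_less l' l}"
  have fin: "finite (?I B)" "finite (?I B')"
    by (rule finite_subset[of _ "A \<times> B"], use assms in auto)
       (rule finite_subset[of _ "A \<times> B'"], use assms in auto)
  have "?I (B \<union> B') = ?I B \<union> ?I B'" by auto
  moreover have "?I B \<inter> ?I B' = {}" using assms(4) by auto
  ultimately have "card (?I (B \<union> B')) = card (?I B) + card (?I B')"
    using fin by (simp add: card_Un_disjoint)
  then show ?thesis
    by (simp add: shuffle_sign_def power_add)
qed

lemma shuffle_sign_square [simp]: "shuffle_sign A B * shuffle_sign A B = 1"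
  by (simp add: shuffle_sign_def flip: power_add)

lemma shuffle_sign_single [simp]: "shuffle_sign {l} {m} = (if leg_less m l then -1 else 1)"
proof -
  have "{(k, k'). k \<in> {l} \<and> k' \<in> {m} \<and> leg_less k' k} = (if leg_less m l then {(l, m)} else {})"
    by auto
  then show ?thesis by (simp add: shuffle_sign_def)
qed

text \<open>The order on legs is total and disjoint sets have no ties, so each pair in
  \<open>A \<times> B\<close> is an inversion for exactly one of the two orders; the two counts add
  up to \<open>card A * card B\<close>.\<close>

lemma shuffle_sign_swap:
  assumes "finite A" "finite B" "A \<inter> B = {}"
  shows "shuffle_sign A B = (-1) ^ (card A * card B) * shuffle_sign B A"
proof -
  let ?I = "{(l, l'). l \<in> A \<and> l' \<in> B \<and> leg_less l' l}"
  let ?J = "{(l, l'). l \<in> B \<and> l' \<in> A \<and> leg_less l' l}"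
  have sub: "?I \<subseteq> A \<times> B" by auto
  have swap: "leg_less l l' \<longleftrightarrow> \<not> leg_less l' l" if "l \<in> A" "l' \<in> B" for l l'
    using that assms(3) by (intro leg_less_total) auto
  have "prod.swap ` ?J = {(l, l'). l \<in> A \<and> l' \<in> B \<and> leg_less l l'}"
    by (auto simp: image_iff)
  also have "\<dots> = A \<times> B - ?I"
    using swap by auto
  finally have "A \<times> B - ?I = prod.swap ` ?J" by simp
  moreover have "card (prod.swap ` ?J) = card ?J"
    by (rule card_image) (auto simp: inj_on_def)
  ultimately have "card ?J = card (A \<times> B) - card ?I"
    using card_Diff_subset[OF finite_subset[OF sub] sub] assms by simp
  moreover have "card ?I \<le> card (A \<times> B)"
    using sub assms by (intro card_mono) auto
  ultimately have "card A * card B = card ?I + card ?J"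
    by (simp add: card_cartesian_product)
  then have "(-1::complex) ^ (card A * card B) * (-1) ^ card ?J
      = (-1) ^ card ?I * ((-1) ^ card ?J * (-1) ^ card ?J)"
    by (simp add: power_add)
  also have "(-1::complex) ^ card ?J * (-1) ^ card ?J = 1"
    by (simp flip: power_add)
  finally show ?thesis
    by (simp add: shuffle_sign_def)
qed

section \<open>Coordinates of wedge products of legs\<close>

lemma wedge_legs_Nil: "wedge_legs [] S = (if S = {} then 1 else 0)"
  by (auto simp: wedge_legs_def)

text \<open>Inversions involving position 0 are those counted by \<open>shuffle_sign {l}\<close>;
  the others are shifted inversions of \<open>ls\<close>. A repeated leg or a wrong \<open>S\<close>
  makes both sides 0.\<close>

lemma wedge_legs_Cons:
  "wedge_legs (l # ls) S =
     (if l \<in> S then shuffle_sign {l} (S - {l}) * wedge_legs ls (S - {l}) else 0)"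
proof (cases "distinct (l # ls) \<and> S = set (l # ls)")
  case True
  let ?J = "{(i, j). i < j \<and> j < length ls \<and> leg_less (ls ! j) (ls ! i)}"
  let ?K = "{j. j < length ls \<and> leg_less (ls ! j) l}"
  have Sl: "S - {l} = set ls" using True by auto
  have "{(i, j). i < j \<and> j < length (l # ls) \<and> leg_less ((l # ls) ! j) ((l # ls) ! i)}
      = Pair 0 ` Suc ` ?K \<union> map_prod Suc Suc ` ?J" (is "?L = ?R")
  proof
    show "?L \<subseteq> ?R"
    proof
      fix x assume "x \<in> ?L"
      then obtain i j where x: "x = (i, j)" "i < j" "j < length (l # ls)"
        "leg_less ((l # ls) ! j) ((l # ls) ! i)" by auto
      then obtain j' where j: "j = Suc j'" by (cases j) auto
      show "x \<in> ?R"
        using x j by (cases i) (auto simp: image_iff)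
    qed
  qed auto
  moreover have "Pair 0 ` Suc ` ?K \<inter> map_prod Suc Suc ` ?J = {}" by auto
  moreover have "finite ?J"
    by (rule finite_subset[of _ "{..<length ls} \<times> {..<length ls}"]) auto
  moreover have "card (Pair (0::nat) ` Suc ` ?K) = card ?K"
    by (simp add: card_image inj_on_def)
  moreover have "card (map_prod Suc Suc ` ?J) = card ?J"
    by (rule card_image) (auto simp: inj_on_def)
  ultimately have "card {(i, j). i < j \<and> j < length (l # ls) \<and> leg_less ((l # ls) ! j) ((l # ls) ! i)}
      = card ?K + card ?J"
    by (simp add: card_Un_disjoint)
  \<comment> \<open>Since \<open>ls\<close> is distinct, its positions correspond to its
    legs.\<close>
  moreover have "card ?K = card {(k, k'). k \<in> {l} \<and> k' \<in> set ls \<and> leg_less k' k}"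
  proof (rule bij_betw_same_card[of "\<lambda>j. (l, ls ! j)"])
    show "bij_betw (\<lambda>j. (l, ls ! j)) ?K {(k, k'). k \<in> {l} \<and> k' \<in> set ls \<and> leg_less k' k}"
      using True by (auto simp: bij_betw_def inj_on_def nth_eq_iff_index_eq image_iff in_set_conv_nth)
        (metis)
  qed
  ultimately show ?thesis
    using True unfolding Sl by (simp add: wedge_legs_def shuffle_sign_def power_add)
next
  case False
  then have "wedge_legs (l # ls) S = 0" by (simp only: wedge_legs_def if_False)
  moreover have "wedge_legs ls (S - {l}) = 0" if "l \<in> S"
    using False that by (auto simp: wedge_legs_def)
  ultimately show ?thesis by simp
qed

lemma wedge_legs_eq_0: "S \<noteq> set ls \<Longrightarrow> wedge_legs ls S = 0"
  by (simp add: wedge_legs_def)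

text \<open>A monomial has at most one nonzero coordinate, at its set of legs, so \<open>S\<close>
  can split only into \<open>set ls\<close> and the rest. The factor
  \<open>wedge_legs ls (set ls)\<close> is the sign that sorts \<open>ls\<close>, or 0 if a leg
  repeats.\<close>

lemma wedge_legs_append:
  assumes "finite S"
  shows "wedge_legs (ls @ ls') S =
     (if set ls \<subseteq> S then shuffle_sign (set ls) (S - set ls) * wedge_legs ls (set ls)
        * wedge_legs ls' (S - set ls) else 0)"
  using assms
proof (induction ls arbitrary: S)
  case Nil
  then show ?case by (simp add: wedge_legs_Nil shuffle_sign_def)
next
  case (Cons l ls)
  show ?case
  proof (cases "l \<in> S \<and> l \<notin> set ls \<and> set ls \<subseteq> S")
    case True
    have S1: "S - {l} = set ls \<union> (S - insert l (set ls))"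
      and S2: "insert l (set ls) = {l} \<union> set ls"
      and S3: "S - {l} - set ls = S - insert l (set ls)"
      and S4: "insert l (set ls) - {l} = set ls"
      using True by auto
    \<comment> \<open>Of these two factors, the first goes into the sorting sign of
      \<open>l # ls\<close>, the second into the shuffle sign of
      \<open>insert l (set ls)\<close>.\<close>
    have e1: "shuffle_sign {l} (S - {l})
        = shuffle_sign {l} (set ls) * shuffle_sign {l} (S - insert l (set ls))"
      unfolding S1 using Cons.prems by (intro shuffle_sign_Un_right) auto
    have e2: "shuffle_sign (insert l (set ls)) (S - insert l (set ls))
        = shuffle_sign {l} (S - insert l (set ls)) * shuffle_sign (set ls) (S - insert l (set ls))"
      using True Cons.prems by (subst S2, intro shuffle_sign_Un_left) auto
    have "set ls \<subseteq> S - {l}" using True by auto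
    with True have "wedge_legs (l # (ls @ ls')) S = shuffle_sign {l} (S - {l}) *
        (shuffle_sign (set ls) (S - {l} - set ls) * wedge_legs ls (set ls) * wedge_legs ls' (S - {l} - set ls))"
      using Cons.prems by (simp add: wedge_legs_Cons Cons.IH)
    moreover have "wedge_legs (l # ls) (set (l # ls)) = shuffle_sign {l} (set ls) * wedge_legs ls (set ls)"
      using S4 by (simp add: wedge_legs_Cons)
    ultimately show ?thesis
      using True unfolding S3 e1 by (simp add: e2)
  next
    case False
    have "wedge_legs (l # (ls @ ls')) S = 0"
      using False Cons.prems by (auto simp: wedge_legs_Cons Cons.IH subset_Diff_insert)
    moreover have "\<not> set (l # ls) \<subseteq> S \<or> wedge_legs (l # ls) (set (l # ls)) = 0"
      using False by (auto simp: wedge_legs_def)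
    ultimately show ?thesis by auto
  qed
qed

section \<open>Smooth functions\<close>

lemma frechet_derivative_cong_open:
  assumes "open S" "x \<in> S" "\<And>y. y \<in> S \<Longrightarrow> f y = g y"
  shows "frechet_derivative f (at x) = frechet_derivative g (at x)"
    and "f differentiable (at x) \<longleftrightarrow> g differentiable (at x)"
proof -
  have "(f has_derivative D) (at x) \<longleftrightarrow> (g has_derivative D) (at x)" for D
    using assms has_derivative_transform_within_open[of f D x UNIV S g]
      has_derivative_transform_within_open[of g D x UNIV S f] by auto
  then show "frechet_derivative f (at x) = frechet_derivative g (at x)"
    "f differentiable (at x) \<longleftrightarrow> g differentiable (at x)"
    by (simp_all add: frechet_derivative_def differentiable_def)
qed

text \<open>A Frechet derivative at a point of an open set depends only on values in that set. So
  the derivative of a sum or product may be replaced by its formula, which is known only on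
  \<open>S\<close>.\<close>

lemma Ck_on_cong:
  assumes "open S" "\<And>y. y \<in> S \<Longrightarrow> f y = g y"
  shows "Ck_on k S f \<longleftrightarrow> Ck_on k S g"
  using assms(2)
proof (induction k arbitrary: f g)
  case 0
  then show ?case using continuous_on_cong[OF refl, of S f g] by simp
next
  case (Suc k)
  have "Ck_on k S (\<lambda>x. frechet_derivative f (at x) v)
      \<longleftrightarrow> Ck_on k S (\<lambda>x. frechet_derivative g (at x) v)" for v
  proof (rule Suc.IH)
    show "frechet_derivative f (at y) v = frechet_derivative g (at y) v" if "y \<in> S" for y
      using frechet_derivative_cong_open(1)[OF assms(1) that, of f g] Suc.prems by simp
  qed
  moreover have "(\<forall>x\<in>S. f differentiable (at x)) \<longleftrightarrow> (\<forall>x\<in>S. g differentiable (at x))"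
    by (intro ball_cong refl frechet_derivative_cong_open(2)[OF assms(1)] Suc.prems)
  ultimately show ?case by simp
qed

text \<open>The Leibniz rule leaves one factor undifferentiated, and that factor is then needed at
  the lower order.\<close>

lemma Ck_on_lower: "Ck_on (Suc k) S f \<Longrightarrow> Ck_on k S f"
proof (induction k arbitrary: f)
  case 0
  then show ?case
    by (auto intro!: continuous_at_imp_continuous_on differentiable_imp_continuous_within)
next
  case (Suc k)
  have "\<forall>x\<in>S. f differentiable (at x)" "Ck_on (Suc k) S (\<lambda>x. frechet_derivative f (at x) v)" for v
    using Suc.prems unfolding Ck_on.simps(2)[of "Suc k"] by blast+
  then show ?case using Suc.IH unfolding Ck_on.simps(2)[of k] by blast
qed

lemma Ck_on_const: "Ck_on k S (\<lambda>_. c)"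
proof (induction k arbitrary: c)
  case (Suc k)
  then show ?case by (simp only: Ck_on.simps frechet_derivative_const) simp
qed simp

lemma Ck_on_add:
  assumes "open S" "Ck_on k S f" "Ck_on k S g"
  shows "Ck_on k S (\<lambda>x. f x + g x)"
  using assms(2,3)
proof (induction k arbitrary: f g)
  case 0
  then show ?case by (simp add: continuous_on_add)
next
  case (Suc k)
  have "Ck_on k S (\<lambda>x. frechet_derivative (\<lambda>x. f x + g x) (at x) v)" for v
  proof (subst Ck_on_cong[OF assms(1)])
    show "Ck_on k S (\<lambda>x. frechet_derivative f (at x) v + frechet_derivative g (at x) v)"
      using Suc by simp
    show "frechet_derivative (\<lambda>x. f x + g x) (at y) v
        = frechet_derivative f (at y) v + frechet_derivative g (at y) v" if "y \<in> S" for y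
    proof -
      have "(f has_derivative frechet_derivative f (at y)) (at y)"
           "(g has_derivative frechet_derivative g (at y)) (at y)"
        using Suc.prems that by (auto simp: frechet_derivative_works)
      from fun_cong[OF frechet_derivative_at[OF has_derivative_add[OF this]], of v]
      show ?thesis by simp
    qed
  qed
  moreover have "\<forall>x\<in>S. (\<lambda>x. f x + g x) differentiable (at x)"
    using Suc.prems by simp
  ultimately show ?case by simp
qed

lemma Ck_on_mult:
  assumes "open S" "Ck_on k S f" "Ck_on k S g"
  shows "Ck_on k S (\<lambda>x. f x * g x)"
  using assms(2,3)
proof (induction k arbitrary: f g)
  case 0
  then show ?case by (simp add: continuous_on_mult)
next
  case (Suc k)
  have "Ck_on k S (\<lambda>x. frechet_derivative (\<lambda>x. f x * g x) (at x) v)" for v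
  proof (subst Ck_on_cong[OF assms(1)])
    show "Ck_on k S (\<lambda>x. f x * frechet_derivative g (at x) v + frechet_derivative f (at x) v * g x)"
      using Suc.prems Ck_on_lower[OF Suc.prems(1)] Ck_on_lower[OF Suc.prems(2)]
      by (intro Ck_on_add[OF assms(1)] Suc.IH) auto
    show "frechet_derivative (\<lambda>x. f x * g x) (at y) v
        = f y * frechet_derivative g (at y) v + frechet_derivative f (at y) v * g y"
      if "y \<in> S" for y
    proof -
      have "(f has_derivative frechet_derivative f (at y)) (at y)"
           "(g has_derivative frechet_derivative g (at y)) (at y)"
        using Suc.prems that by (auto simp: frechet_derivative_works)
      from fun_cong[OF frechet_derivative_at[OF has_derivative_mult[OF this]], of v]
      show ?thesis by simp
    qed
  qed
  moreover have "\<forall>x\<in>S. (\<lambda>x. f x * g x) differentiable (at x)"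
    using Suc.prems by simp
  ultimately show ?case by simp
qed

text \<open>Keeps the coefficient of a product of two terms admissible in
  \<open>tau_graph\<close>.\<close>

lemma smooth_on_mult:
  "open S \<Longrightarrow> smooth_on S f \<Longrightarrow> smooth_on S g \<Longrightarrow> smooth_on S (\<lambda>x. f x * g x)"
  unfolding smooth_on_def using Ck_on_mult by blast

lemma smooth_on_const: "smooth_on S (\<lambda>_. c)"
  by (simp add: smooth_on_def Ck_on_const)

section \<open>The wedge product\<close>

lemma ext_wedge_add_left:
  "ext_wedge (\<lambda>q S x. w q S x + w' q S x) v = (\<lambda>q S x. ext_wedge w v q S x + ext_wedge w' v q S x)"
  by (intro ext) (simp add: ext_wedge_def algebra_simps sum.distrib)

lemma ext_wedge_add_right:
  "ext_wedge v (\<lambda>q S x. w q S x + w' q S x) = (\<lambda>q S x. ext_wedge v w q S x + ext_wedge v w' q S x)"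
  by (intro ext) (simp add: ext_wedge_def algebra_simps sum.distrib)

text \<open>Only \<open>A = set ls\<close> contributes, and a nonzero coordinate there forces
  \<open>ls\<close> to be distinct, so that \<open>card A\<close> is \<open>length ls\<close> in the
  Koszul sign.\<close>

lemma sum_wedge_legs:
  "(\<Sum>A\<in>Pow S. (-1) ^ (card A * k) * shuffle_sign A (S - A) * wedge_legs ls A * wedge_legs ls' (S - A))
     = (-1) ^ (length ls * k) * wedge_legs (ls @ ls') S"
proof (cases "finite S")
  case True
  have "(\<Sum>A\<in>Pow S. (-1) ^ (card A * k) * shuffle_sign A (S - A) * wedge_legs ls A * wedge_legs ls' (S - A))
      = (\<Sum>A\<in>Pow S. if A = set ls then (-1) ^ (length ls * k) * shuffle_sign (set ls) (S - set ls)
          * wedge_legs ls (set ls) * wedge_legs ls' (S - set ls) else 0)"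
    by (intro sum.cong refl) (auto simp: wedge_legs_def distinct_card)
  also have "\<dots> = (-1) ^ (length ls * k) * wedge_legs (ls @ ls') S"
    using True by (simp add: wedge_legs_append)
  finally show ?thesis .
next
  case False
  \<comment> \<open>For infinite \<open>S\<close> the sum over \<open>Pow S\<close> is 0 by
    convention.\<close>
  then have "wedge_legs (ls @ ls') S = 0" by (intro wedge_legs_eq_0) auto
  with False show ?thesis by simp
qed

text \<open>The sign from moving \<open>d(zbar)\<close> past legs goes into the coefficient, and
  form degree above 1 gives the zero term, so a product of terms is literally a term again.\<close>

lemma ext_wedge_ext_term:
  "ext_wedge (ext_term D ls q g) (ext_term D ls' q' g') =
     (if q + q' \<le> 1
      then ext_term D (ls @ ls') (q + q') (\<lambda>x. (-1) ^ (length ls * q') * (g x * g' x))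
      else ext_term D [] 0 (\<lambda>_. 0))"
proof (intro ext)
  fix n S x
  have "(\<Sum>A\<in>Pow S. (-1) ^ (card A * (n - p)) * shuffle_sign A (S - A)
          * ext_term D ls q g p A x * ext_term D ls' q' g' (n - p) (S - A) x)
      = (if p = q then if n = q + q' \<and> x \<in> D
          then g x * g' x * ((-1) ^ (length ls * q') * wedge_legs (ls @ ls') S) else 0 else 0)"
    if "p \<le> n" for p
  proof (cases "p = q \<and> n = q + q' \<and> x \<in> D")
    case True
    then have "(\<Sum>A\<in>Pow S. (-1) ^ (card A * (n - p)) * shuffle_sign A (S - A)
          * ext_term D ls q g p A x * ext_term D ls' q' g' (n - p) (S - A) x)
        = g x * g' x * (\<Sum>A\<in>Pow S. (-1) ^ (card A * q') * shuffle_sign A (S - A)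
          * wedge_legs ls A * wedge_legs ls' (S - A))"
      by (simp add: ext_term_def sum_distrib_left mult_ac)
    with True show ?thesis
      by (simp add: sum_wedge_legs)
  next
    case False
    then have "ext_term D ls q g p A x * ext_term D ls' q' g' (n - p) (S - A) x = 0" for A
      using that by (auto simp: ext_term_def)
    then have "(\<Sum>A\<in>Pow S. (-1) ^ (card A * (n - p)) * shuffle_sign A (S - A)
          * ext_term D ls q g p A x * ext_term D ls' q' g' (n - p) (S - A) x) = 0"
      by (intro sum.neutral) (simp add: mult.assoc)
    then show ?thesis
      using False by auto
  qed
  then have "(\<Sum>p\<le>n. \<Sum>A\<in>Pow S. (-1) ^ (card A * (n - p)) * shuffle_sign A (S - A)
          * ext_term D ls q g p A x * ext_term D ls' q' g' (n - p) (S - A) x)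
      = (\<Sum>p\<le>n. if p = q then if n = q + q' \<and> x \<in> D
          then g x * g' x * ((-1) ^ (length ls * q') * wedge_legs (ls @ ls') S) else 0 else 0)"
    by simp
  also have "\<dots> = (if n = q + q' \<and> x \<in> D
      then g x * g' x * ((-1) ^ (length ls * q') * wedge_legs (ls @ ls') S) else 0)"
    by simp
  finally show "ext_wedge (ext_term D ls q g) (ext_term D ls' q' g') n S x =
     (if q + q' \<le> 1
      then ext_term D (ls @ ls') (q + q') (\<lambda>x. (-1) ^ (length ls * q') * (g x * g' x))
      else ext_term D [] 0 (\<lambda>_. 0)) n S x"
    unfolding ext_wedge_def by (auto simp: ext_term_def)
qed

lemma tau_graph_zero: "tau_graph r D (cl_term [] 0 (\<lambda>_. 0)) (ext_term D [] 0 (\<lambda>_. 0))"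
  by (intro tau_graph.intros smooth_on_const) auto

text \<open>Bilinearity and two inductions reduce this to single terms. A mere witness
  \<open>C\<close> suffices: it puts the wedge product into the range of \<open>tau\<close>.\<close>

lemma tau_graph_ext_wedge:
  assumes "open D" "tau_graph r D A w" "tau_graph r D B w'"
  shows "\<exists>C. tau_graph r D C (ext_wedge w w')"
  using assms(2)
proof induction
  case (1 g q ls)
  note t = this
  show ?case
    using assms(3)
  proof induction
    case (1 g' q' ls')
    show ?case
    proof (cases "q + q' \<le> 1")
      case True
      have "tau_graph r D (cl_term (ls @ ls') (q + q') (\<lambda>x. (-1) ^ (length ls * q') * (g x * g' x)))
          (ext_term D (ls @ ls') (q + q') (\<lambda>x. (-1) ^ (length ls * q') * (g x * g' x)))"
        using t 1 True
        by (intro tau_graph.intros(1) smooth_on_mult smooth_on_const assms) auto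
      with True show ?thesis by (auto simp: ext_wedge_ext_term)
    next
      case False
      then show ?thesis using tau_graph_zero by (auto simp: ext_wedge_ext_term)
    qed
  next
    case (2 A v B v')
    then show ?case by (auto simp: ext_wedge_add_right intro: tau_graph.intros(2))
  qed
next
  case (2 A v B v')
  then show ?case by (auto simp: ext_wedge_add_left intro: tau_graph.intros(2))
qed

section \<open>Parity and supercommutativity\<close>

definition ext_homogeneous :: "nat \<Rightarrow> ext_section \<Rightarrow> bool" where
  "ext_homogeneous \<epsilon> w \<longleftrightarrow> (\<forall>q S x. w q S x \<noteq> 0 \<longrightarrow> (q + card S) mod 2 = \<epsilon>)"

text \<open>Exchanging \<open>A\<close> with its complement and \<open>p\<close> with
  \<open>n - p\<close> matches the terms of the two products; Koszul signs and shuffle signs combine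
  to the parity sign.\<close>

lemma ext_wedge_supercommute:
  assumes "ext_homogeneous \<epsilon> w" "ext_homogeneous \<delta> w'"
  shows "ext_wedge w w' = (\<lambda>n S x. (-1) ^ (\<epsilon> * \<delta>) * ext_wedge w' w n S x)"
proof (intro ext)
  fix n S x
  show "ext_wedge w w' n S x = (-1) ^ (\<epsilon> * \<delta>) * ext_wedge w' w n S x"
  proof (cases "n \<le> 1 \<and> finite S")
    case True
    have term_eq: "(-1) ^ (card A * (n - p)) * shuffle_sign A (S - A) * w p A x * w' (n - p) (S - A) x
        = (-1) ^ (\<epsilon> * \<delta>) * ((-1) ^ (card (S - A) * p) * shuffle_sign (S - A) A
            * w' (n - p) (S - A) x * w p A x)"
      if "p \<le> n" "A \<subseteq> S" for p A
    proof (cases "w p A x = 0 \<or> w' (n - p) (S - A) x = 0")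
      case False
      have \<epsilon>: "\<epsilon> = (p + card A) mod 2" and \<delta>: "\<delta> = (n - p + card (S - A)) mod 2"
        using False assms unfolding ext_homogeneous_def by metis+
      \<comment> \<open>Expanding \<open>\<epsilon> * \<delta>\<close> modulo 2 gives a term
        \<open>p * (n - p)\<close> besides the wanted ones; form degree at most 1 makes it
        vanish.\<close>
      have "p = 0 \<or> n - p = 0" using True that by auto
      then have "even (card A * (n - p) + card A * card (S - A) + (card (S - A) * p + \<epsilon> * \<delta>))"
        unfolding \<epsilon> \<delta> by (auto simp: even_add mod2_eq_if)
      then have "(-1::complex) ^ (card A * (n - p)) * (-1) ^ (card A * card (S - A))
          = (-1) ^ (\<epsilon> * \<delta>) * (-1) ^ (card (S - A) * p)"
        by (auto simp: minus_one_power_iff)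
      moreover have "shuffle_sign A (S - A) = (-1) ^ (card A * card (S - A)) * shuffle_sign (S - A) A"
        using True that by (intro shuffle_sign_swap) (auto intro: finite_subset)
      ultimately show ?thesis by (simp add: mult_ac)
    qed auto
    have "ext_wedge w w' n S x = (\<Sum>p\<le>n. \<Sum>A\<in>Pow S. (-1) ^ (\<epsilon> * \<delta>) *
        ((-1) ^ (card (S - A) * p) * shuffle_sign (S - A) A * w' (n - p) (S - A) x * w p A x))"
      using True by (simp add: ext_wedge_def term_eq)
    also have "\<dots> = (-1) ^ (\<epsilon> * \<delta>) * (\<Sum>p\<le>n. \<Sum>A\<in>Pow S.
        (-1) ^ (card (S - A) * p) * shuffle_sign (S - A) A * w' (n - p) (S - A) x * w p A x)"
      by (simp add: sum_distrib_left)
    also have "(\<Sum>p\<le>n. \<Sum>A\<in>Pow S.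
        (-1) ^ (card (S - A) * p) * shuffle_sign (S - A) A * w' (n - p) (S - A) x * w p A x)
        = (\<Sum>p\<le>n. \<Sum>A\<in>Pow S.
        (-1) ^ (card A * (n - p)) * shuffle_sign A (S - A) * w' p A x * w (n - p) (S - A) x)"
    proof (rule sum.reindex_bij_witness[of _ "\<lambda>p. n - p" "\<lambda>p. n - p"], goal_cases)
      case (5 p)
      show ?case
        using 5
        by (intro sum.reindex_bij_witness[of _ "\<lambda>A. S - A" "\<lambda>A. S - A"]) (auto simp: double_diff)
    qed auto
    finally show ?thesis using True by (simp add: ext_wedge_def)
  next
    case False
    then show ?thesis by (auto simp: ext_wedge_def)
  qed
qed

lemma cl_reps_tau_graph:
  assumes "A \<in> cl_reps r D {\<epsilon>}"
  shows "\<exists>w. tau_graph r D A w \<and> ext_homogeneous \<epsilon> w"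
  using assms
proof induction
  case (1 g q ls)
  have "ext_homogeneous \<epsilon> (ext_term D ls q g)"
    using 1(4) unfolding ext_homogeneous_def ext_term_def
    by (auto simp: wedge_legs_def distinct_card split: if_splits)
  with 1 show ?case by (blast intro: tau_graph.intros(1))
next
  case (2 A B)
  then obtain w w' where w: "tau_graph r D A w" "ext_homogeneous \<epsilon> w"
    "tau_graph r D B w'" "ext_homogeneous \<epsilon> w'" by blast
  have "ext_homogeneous \<epsilon> (\<lambda>q S x. w q S x + w' q S x)"
    unfolding ext_homogeneous_def
  proof (intro allI impI)
    fix q S x
    assume "w q S x + w' q S x \<noteq> 0"
    then have "w q S x \<noteq> 0 \<or> w' q S x \<noteq> 0" by auto
    with w(2,4) show "(q + card S) mod 2 = \<epsilon>" unfolding ext_homogeneous_def by blast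
  qed
  with w show ?case by (blast intro: tau_graph.intros(2))
qed

lemma tau_graph_cl_reps: "tau_graph r D A w \<Longrightarrow> A \<in> cl_reps r D {0, 1}"
  by (induction rule: tau_graph.induct) (auto intro: cl_reps.intros)

section \<open>Laurent expansions\<close>

text \<open>\<open>laurent_expansion\<close> is total, so a genuine expansion has to be exhibited:
  that of the holomorphic numerator divided by a power of the coordinate.\<close>

lemma merom_at_has_laurent_expansion:
  assumes "open D" "x \<in> D" "merom_at D x f"
  shows "(\<lambda>w. f (x + w)) has_laurent_expansion laurent_expansion f x"
proof -
  obtain m g where g: "g holomorphic_on D" "\<And>t. t \<in> D - {x} \<Longrightarrow> f t = g t / (t - x) ^ m"
    using assms(3) unfolding merom_at_def by blast
  have "g analytic_on {x}"
    using g(1) assms(1,2) analytic_at by blast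
  then have "(\<lambda>w. g (x + w)) has_laurent_expansion fps_to_fls (fps_expansion g x)"
    by (intro has_laurent_expansion_fps analytic_at_imp_has_fps_expansion)
  then have *: "(\<lambda>w. g (x + w) / w ^ m) has_laurent_expansion
      fps_to_fls (fps_expansion g x) / fls_X_intpow (int m)"
    by (intro has_laurent_expansion_divide has_laurent_expansion_fps_X_power)
  have "eventually (\<lambda>t. f t = g t / (t - x) ^ m) (at x)"
    using g(2) assms by (auto simp: eventually_at_topological)
  from has_laurent_expansion_cong'[OF this refl refl] *
  have "(\<lambda>w. f (x + w)) has_laurent_expansion
      fps_to_fls (fps_expansion g x) / fls_X_intpow (int m)"
    by simp
  with laurent_expansion_eqI show ?thesis by metis
qed

lemma laurent_expansion_cong_on:
  assumes "open D" "x \<in> D" "\<And>t. t \<in> D - {x} \<Longrightarrow> f t = g t"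
  shows "laurent_expansion f x = laurent_expansion g x"
  using assms by (intro laurent_expansion_cong) (auto simp: eventually_at_topological)

lemma laurent_expansion_holomorphic_neg:
  assumes "open D" "x \<in> D" "f holomorphic_on D" "n < 0"
  shows "fls_nth (laurent_expansion f x) n = 0"
proof -
  have "f analytic_on {x}"
    using assms analytic_at by blast
  then have "(\<lambda>w. f (x + w)) has_laurent_expansion fps_to_fls (fps_expansion f x)"
    by (intro has_laurent_expansion_fps analytic_at_imp_has_fps_expansion)
  then have "laurent_expansion f x = fps_to_fls (fps_expansion f x)"
    by (rule laurent_expansion_eqI)
  with assms(4) show ?thesis by simp
qed

text \<open>The coefficient of index -1 of a formal derivative carries the factor 0. Hence exact
  forms will act as zero.\<close>

lemma laurent_expansion_deriv_residue:
  assumes "open D" "x \<in> D" "merom_at D x f"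
  shows "fls_nth (laurent_expansion (deriv f) x) (-1) = 0"
proof -
  have "deriv (\<lambda>w. f (x + w)) has_laurent_expansion fls_deriv (laurent_expansion f x)"
    using merom_at_has_laurent_expansion[OF assms] by (rule has_laurent_expansion_deriv)
  also have "deriv (\<lambda>w. f (x + w)) = (\<lambda>w. deriv f (x + w))"
    using deriv_shift_0[of f] by (auto simp: fun_eq_iff deriv_shift_0' o_def add_ac)
  finally have "laurent_expansion (deriv f) x = fls_deriv (laurent_expansion f x)"
    by (rule laurent_expansion_eqI)
  then show ?thesis by simp
qed

lemma laurent_expansion_lin:
  assumes "open D" "x \<in> D" "merom_at D x f" "merom_at D x g"
    and "\<And>t. t \<in> D - {x} \<Longrightarrow> h t = c * f t + g t"
  shows "fls_nth (laurent_expansion h x) n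
    = c * fls_nth (laurent_expansion f x) n + fls_nth (laurent_expansion g x) n"
proof -
  have "laurent_expansion h x = laurent_expansion (\<lambda>t. c * f t + g t) x"
    using assms by (intro laurent_expansion_cong_on) auto
  also have "\<dots> = fls_const c * laurent_expansion f x + laurent_expansion g x"
    using merom_at_has_laurent_expansion[OF assms(1-3)]
      merom_at_has_laurent_expansion[OF assms(1,2,4)]
    by (intro laurent_expansion_eqI has_laurent_expansion_add has_laurent_expansion_cmult_left)
  finally show ?thesis by simp
qed

lemma laurent_expansion_pole:
  "laurent_expansion (\<lambda>t. c / (t - x) ^ k) x = fls_const c * fls_X_intpow (- int k)"
proof (rule laurent_expansion_eqI)
  have "(\<lambda>w. c * w powi (- int k)) has_laurent_expansion fls_const c * fls_X_intpow (- int k)"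
    by (intro has_laurent_expansion_cmult_left has_laurent_expansion_fps_X_power_int)
  then show "(\<lambda>w. c / (x + w - x) ^ k) has_laurent_expansion fls_const c * fls_X_intpow (- int k)"
    by (simp add: power_int_minus divide_inverse)
qed

text \<open>Two indices with sum -1 have exactly one negative member, so the residue pairs polar
  parts with Taylor parts. The bound \<open>M\<close> on both pole orders makes the sums
  finite.\<close>

lemma fls_residue_mult:
  fixes F G :: "'a::comm_ring_1 fls"
  assumes "- int M \<le> fls_subdegree F" "- int M \<le> fls_subdegree G"
  shows "fls_nth (F * G) (-1) = (\<Sum>n<M. fls_nth F (- int n - 1) * fls_nth G (int n)
           + fls_nth F (int n) * fls_nth G (- int n - 1))"
proof -
  have minus_one: "- 1 - i = - i - 1" for i :: int by simp
  have "fls_nth (F * G) (-1) = (\<Sum>i=fls_subdegree F..- 1 - fls_subdegree G.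
      fls_nth F i * fls_nth G (- 1 - i))"
    by (simp add: fls_times_nth(2))
  also have "\<dots> = (\<Sum>i\<in>{- int M..<0} \<union> {0..<int M}. fls_nth F i * fls_nth G (- 1 - i))"
    using assms
    by (intro sum.mono_neutral_left) (auto simp: not_le fls_eq0_below_subdegree)
  also have "\<dots> = (\<Sum>i\<in>{- int M..<0}. fls_nth F i * fls_nth G (- 1 - i))
      + (\<Sum>i\<in>{0..<int M}. fls_nth F i * fls_nth G (- 1 - i))"
    by (intro sum.union_disjoint) auto
  also have "(\<Sum>i\<in>{- int M..<0}. fls_nth F i * fls_nth G (- 1 - i))
      = (\<Sum>n<M. fls_nth F (- int n - 1) * fls_nth G (int n))"
    by (rule sum.reindex_bij_witness[of _ "\<lambda>n. - int n - 1" "\<lambda>i. nat (- i - 1)"]) (auto simp: minus_one)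
  also have "(\<Sum>i\<in>{0..<int M}. fls_nth F i * fls_nth G (- 1 - i))
      = (\<Sum>n<M. fls_nth F (int n) * fls_nth G (- int n - 1))"
    by (rule sum.reindex_bij_witness[of _ int nat]) (auto simp: minus_one)
  finally show ?thesis by (simp add: sum.distrib)
qed

section \<open>The Fock representation\<close>

text \<open>Creating and contracting \<open>l\<close> both connect \<open>S\<close> with the set
  where membership of \<open>l\<close> is flipped, so one involution serves both.\<close>

definition toggle :: "leg \<Rightarrow> leg set \<Rightarrow> leg set" where
  "toggle l S = (if l \<in> S then S - {l} else insert l S)"

lemma toggle_toggle [simp]: "toggle l (toggle l S) = S"
  by (auto simp: toggle_def)

lemma toggle_commute: "toggle l (toggle m S) = toggle m (toggle l S)"
  by (auto simp: toggle_def)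

lemma in_toggle: "m \<in> toggle l S \<longleftrightarrow> (if m = l then m \<notin> S else m \<in> S)"
  by (auto simp: toggle_def)

lemma finite_toggle [simp]: "finite (toggle l S) \<longleftrightarrow> finite S"
  by (auto simp: toggle_def)

lemma toggle_Diff [simp]: "toggle l S - {l} = S - {l}"
  by (auto simp: toggle_def)

text \<open>Flipping \<open>l\<close> adds or removes one factor
  \<open>shuffle_sign {m} {l}\<close>, which is its own inverse and equals
  \<open>- shuffle_sign {l} {m}\<close>. The minus sign is displayed because it produces the
  anticommutation.\<close>

lemma shuffle_sign_toggle:
  assumes "finite S" "l \<noteq> m"
  shows "shuffle_sign {m} (toggle l S - {m})
       = shuffle_sign {l} {m} * - shuffle_sign {m} (S - {m})"
proof -
  have ins: "shuffle_sign {m} (insert l B) = shuffle_sign {m} {l} * shuffle_sign {m} B"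
    if "l \<notin> B" "finite B" for B
    using shuffle_sign_Un_right[of "{m}" "{l}" B] that by simp
  have flip: "shuffle_sign {m} {l} = - shuffle_sign {l} {m}"
    using leg_less_total[OF assms(2)] by simp
  have sq: "shuffle_sign {m} {l} * shuffle_sign {m} {l} = 1" by simp
  show ?thesis
  proof (cases "l \<in> S")
    case True
    have "S - {m} = insert l (S - {l} - {m})" using True assms by auto
    then have "shuffle_sign {m} (S - {m}) = shuffle_sign {m} {l} * shuffle_sign {m} (S - {l} - {m})"
      using ins[of "S - {l} - {m}"] assms(1) by simp
    then show ?thesis
      using True flip by (simp add: toggle_def split: if_splits)
  next
    case False
    have "insert l S - {m} = insert l (S - {m})" using assms by auto
    then show ?thesis
      using False ins[of "S - {m}"] assms(1) flip by (simp add: toggle_def)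
  qed
qed

text \<open>
  The transpose of the Clifford operator with creation coefficients \<open>P\<close> and contraction coefficients
  \<open>Q\<close>.  Acting on functionals rather than on vectors, one needs no finiteness assumption on
  \<open>f\<close>: at a finite set \<open>S\<close> only the legs in \<open>S\<close> and in the support of \<open>P\<close> contribute.
\<close>

definition clifford_act ::
    "(leg \<Rightarrow> complex) \<Rightarrow> (leg \<Rightarrow> complex) \<Rightarrow> (leg set \<Rightarrow> complex) \<Rightarrow> leg set \<Rightarrow> complex" where
  "clifford_act P Q f S = (\<Sum>l | (if l \<in> S then Q l else P l) \<noteq> 0.
     (if l \<in> S then Q l else P l) * shuffle_sign {l} (S - {l}) * f (toggle l S))"

text \<open>Replaces the support, which varies with \<open>S\<close>, by one finite index set usable
  for several operators at once.\<close>

lemma clifford_act_eq: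
  assumes "finite N" "\<And>l. l \<notin> N \<Longrightarrow> (if l \<in> S then Q l else P l) = 0"
  shows "clifford_act P Q f S
    = (\<Sum>l\<in>N. (if l \<in> S then Q l else P l) * shuffle_sign {l} (S - {l}) * f (toggle l S))"
  unfolding clifford_act_def
proof (rule sum.mono_neutral_left[OF assms(1)])
  show "{l. (if l \<in> S then Q l else P l) \<noteq> 0} \<subseteq> N"
    using assms(2) by blast
qed simp

text \<open>Distinct legs contribute with opposite signs in the two orders; flipping the same leg
  twice uses one creation and one contraction coefficient and returns to \<open>S\<close>.\<close>

lemma clifford_act_anticommute:
  assumes "finite S" "finite N"
    and N: "\<And>l. l \<notin> N \<Longrightarrow> P l = 0 \<and> P' l = 0 \<and> (l \<in> S \<longrightarrow> Q l = 0 \<and> Q' l = 0)"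
  shows "clifford_act P' Q' (clifford_act P Q f) S + clifford_act P Q (clifford_act P' Q' f) S
       = (\<Sum>l\<in>N. P l * Q' l + Q l * P' l) * f S"
proof -
  \<comment> \<open>The contribution that flips \<open>l\<close> with the outer operator and
    \<open>m\<close> with the inner one.\<close>
  define T where "T P Q P' Q' l m =
      (if l \<in> S then Q' l else P' l) * shuffle_sign {l} (S - {l})
      * ((if m \<in> toggle l S then Q m else P m) * shuffle_sign {m} (toggle l S - {m})
      * f (toggle m (toggle l S)))" for P Q P' Q' :: "leg \<Rightarrow> complex" and l m
  have expand: "clifford_act P' Q' (clifford_act P Q f) S = (\<Sum>l\<in>N. \<Sum>m\<in>N. T P Q P' Q' l m)"
    if "\<And>l. l \<notin> N \<Longrightarrow> P l = 0 \<and> P' l = 0 \<and> (l \<in> S \<longrightarrow> Q l = 0 \<and> Q' l = 0)"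
    for P Q P' Q'
  proof -
    have "clifford_act P' Q' (clifford_act P Q f) S
        = (\<Sum>l\<in>N. (if l \<in> S then Q' l else P' l) * shuffle_sign {l} (S - {l})
            * clifford_act P Q f (toggle l S))"
      using assms that by (intro clifford_act_eq) auto
    also have "\<dots> = (\<Sum>l\<in>N. (if l \<in> S then Q' l else P' l) * shuffle_sign {l} (S - {l})
        * (\<Sum>m\<in>N. (if m \<in> toggle l S then Q m else P m) * shuffle_sign {m} (toggle l S - {m})
            * f (toggle m (toggle l S))))"
    proof (rule sum.cong[OF refl])
      fix l assume "l \<in> N"
      have "clifford_act P Q f (toggle l S)
          = (\<Sum>m\<in>N. (if m \<in> toggle l S then Q m else P m) * shuffle_sign {m} (toggle l S - {m})
            * f (toggle m (toggle l S)))"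
        using \<open>l \<in> N\<close> assms(2) that by (intro clifford_act_eq) (auto simp: in_toggle)
      then show "(if l \<in> S then Q' l else P' l) * shuffle_sign {l} (S - {l}) * clifford_act P Q f (toggle l S)
          = (if l \<in> S then Q' l else P' l) * shuffle_sign {l} (S - {l})
          * (\<Sum>m\<in>N. (if m \<in> toggle l S then Q m else P m) * shuffle_sign {m} (toggle l S - {m})
            * f (toggle m (toggle l S)))" by simp
    qed
    finally show ?thesis by (simp add: T_def sum_distrib_left)
  qed
  have pair: "T P Q P' Q' l m + T P' Q' P Q m l
      = (if m = l then (P l * Q' l + Q l * P' l) * f S else 0)" for l m
  proof (cases "m = l")
    case True
    have "shuffle_sign {l} (S - {l}) * (y * shuffle_sign {l} (S - {l}) * z) = y * z" for y z
    proof -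
      have "shuffle_sign {l} (S - {l}) * (y * shuffle_sign {l} (S - {l}) * z)
          = (shuffle_sign {l} (S - {l}) * shuffle_sign {l} (S - {l})) * (y * z)"
        by (simp only: mult_ac)
      then show ?thesis by simp
    qed
    then show ?thesis
      using True by (simp add: T_def in_toggle mult.assoc) (simp add: algebra_simps)
  next
    case False
    have "shuffle_sign {m} {l} = - shuffle_sign {l} {m}"
      using leg_less_total[of l m] False by simp
    moreover have "toggle l (toggle m S) = toggle m (toggle l S)" by (rule toggle_commute)
    moreover have "shuffle_sign {m} (toggle l S - {m})
       = shuffle_sign {l} {m} * - shuffle_sign {m} (S - {m})"
      "shuffle_sign {l} (toggle m S - {l})
       = shuffle_sign {m} {l} * - shuffle_sign {l} (S - {l})"
      using False assms(1) by (intro shuffle_sign_toggle; simp)+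
    moreover have "m \<in> toggle l S \<longleftrightarrow> m \<in> S" "l \<in> toggle m S \<longleftrightarrow> l \<in> S"
      using False by (auto simp: in_toggle)
    ultimately show ?thesis
      using False unfolding T_def by (simp only: if_False) (simp only: mult_ac, simp add: algebra_simps)
  qed
  have "clifford_act P' Q' (clifford_act P Q f) S + clifford_act P Q (clifford_act P' Q' f) S
      = (\<Sum>l\<in>N. \<Sum>m\<in>N. T P Q P' Q' l m) + (\<Sum>m\<in>N. \<Sum>l\<in>N. T P' Q' P Q m l)"
    using N by (subst (1 2) expand) auto
  also have "(\<Sum>m\<in>N. \<Sum>l\<in>N. T P' Q' P Q m l) = (\<Sum>l\<in>N. \<Sum>m\<in>N. T P' Q' P Q m l)"
    by (rule sum.swap)
  also have "(\<Sum>l\<in>N. \<Sum>m\<in>N. T P Q P' Q' l m) + (\<Sum>l\<in>N. \<Sum>m\<in>N. T P' Q' P Q m l)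
      = (\<Sum>l\<in>N. \<Sum>m\<in>N. if m = l then (P l * Q' l + Q l * P' l) * f S else 0)"
    by (simp add: pair flip: sum.distrib)
  also have "\<dots> = (\<Sum>l\<in>N. P l * Q' l + Q l * P' l) * f S"
    using assms(2) by (simp add: sum_distrib_right)
  finally show ?thesis .
qed

text \<open>
  A section \<open>s\<close> acts by creation with its polar part and by contraction with its Taylor part; the
  factorials come from the leg \<open>(a, n)\<close> standing for \<open>n! e_a / (t - x)^(n+1)\<close>.
\<close>

definition polar_coeff :: "nat \<Rightarrow> complex \<Rightarrow> (complex \<Rightarrow> nat \<Rightarrow> complex) \<Rightarrow> leg \<Rightarrow> complex" where
  "polar_coeff r x s l = (if fst l < 2 * r
     then fls_nth (laurent_expansion (\<lambda>t. s t (fst l)) x) (- int (snd l) - 1) / fact (snd l) else 0)"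

definition taylor_coeff :: "nat \<Rightarrow> complex \<Rightarrow> (complex \<Rightarrow> nat \<Rightarrow> complex) \<Rightarrow> leg \<Rightarrow> complex" where
  "taylor_coeff r x s l = (if fst l < 2 * r
     then \<Sum>a<2 * r. eta r a (fst l) * (fact (snd l) *
       fls_nth (laurent_expansion (\<lambda>t. s t a) x) (int (snd l))) else 0)"

text \<open>Transposition reverses products, so folding a word from the left and evaluating at
  \<open>{}\<close> pairs \<open>f\<close> with the word applied to the vacuum.\<close>

primrec fock_act :: "nat \<Rightarrow> complex \<Rightarrow> (leg set \<Rightarrow> complex) \<Rightarrow> hL_flat \<Rightarrow> leg set \<Rightarrow> complex" where
  "fock_act r x f (EPart s) = clifford_act (polar_coeff r x s) (taylor_coeff r x s) f"
| "fock_act r x f (OmPart w) = (\<lambda>S. fls_nth (laurent_expansion w x) (-1) * f S)"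

lemma eta_commute: "eta r a b = eta r b a"
  by (auto simp: eta_def)

text \<open>The factorials in the two coefficients cancel, leaving the \<open>eta\<close>-pairing of
  polar with Taylor coefficients.\<close>

lemma sum_polar_taylor:
  "(\<Sum>b<2 * r. \<Sum>n<M. polar_coeff r x s (b, n) * taylor_coeff r x s' (b, n))
    = (\<Sum>b<2 * r. \<Sum>a<2 * r. eta r b a *
        (\<Sum>n<M. fls_nth (laurent_expansion (\<lambda>t. s t b) x) (- int n - 1)
          * fls_nth (laurent_expansion (\<lambda>t. s' t a) x) (int n)))"
proof (rule sum.cong[OF refl])
  fix b assume b: "b \<in> {..<2 * r}"
  have "polar_coeff r x s (b, n) * taylor_coeff r x s' (b, n)
      = (\<Sum>a<2 * r. eta r b a * (fls_nth (laurent_expansion (\<lambda>t. s t b) x) (- int n - 1)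
          * fls_nth (laurent_expansion (\<lambda>t. s' t a) x) (int n)))" for n
  proof -
    have "polar_coeff r x s (b, n) * taylor_coeff r x s' (b, n)
      = (\<Sum>a<2 * r. fls_nth (laurent_expansion (\<lambda>t. s t b) x) (- int n - 1) / fact n
          * (eta r a b * (fact n * fls_nth (laurent_expansion (\<lambda>t. s' t a) x) (int n))))"
      using b by (simp add: polar_coeff_def taylor_coeff_def sum_distrib_left)
    also have "\<dots> = (\<Sum>a<2 * r. eta r b a * (fls_nth (laurent_expansion (\<lambda>t. s t b) x) (- int n - 1)
          * fls_nth (laurent_expansion (\<lambda>t. s' t a) x) (int n)))"
      by (rule sum.cong[OF refl]) (simp add: eta_commute)
    finally show ?thesis .
  qed
  then have "(\<Sum>n<M. polar_coeff r x s (b, n) * taylor_coeff r x s' (b, n))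
      = (\<Sum>n<M. \<Sum>a<2 * r. eta r b a * (fls_nth (laurent_expansion (\<lambda>t. s t b) x) (- int n - 1)
          * fls_nth (laurent_expansion (\<lambda>t. s' t a) x) (int n)))" by simp
  also have "\<dots> = (\<Sum>a<2 * r. \<Sum>n<M. eta r b a * (fls_nth (laurent_expansion (\<lambda>t. s t b) x) (- int n - 1)
          * fls_nth (laurent_expansion (\<lambda>t. s' t a) x) (int n)))"
    by (rule sum.swap)
  finally show "(\<Sum>n<M. polar_coeff r x s (b, n) * taylor_coeff r x s' (b, n))
      = (\<Sum>a<2 * r. eta r b a *
        (\<Sum>n<M. fls_nth (laurent_expansion (\<lambda>t. s t b) x) (- int n - 1)
          * fls_nth (laurent_expansion (\<lambda>t. s' t a) x) (int n)))"
    by (simp only: sum_distrib_left)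
qed

text \<open>The anticommutator sums polar times Taylor coefficients in both orders, which is the
  residue of the paired sections: the Lie bracket becomes the Clifford relation.\<close>

lemma fock_act_bracket:
  assumes "open D" "x \<in> D" "finite S"
    and "EPart s \<in> hL_sections r D x" "EPart s' \<in> hL_sections r D x"
  shows "fock_act r x (fock_act r x f (EPart s)) (EPart s') S
       + fock_act r x (fock_act r x f (EPart s')) (EPart s) S
       = fock_act r x f (OmPart (\<lambda>t. \<Sum>a<2 * r. \<Sum>b<2 * r. eta r a b * s t a * s' t b)) S"
proof -
  define F where "F a = laurent_expansion (\<lambda>t. s t a) x" for a
  define G where "G a = laurent_expansion (\<lambda>t. s' t a) x" for a
  have F: "(\<lambda>w. s (x + w) a) has_laurent_expansion F a" if "a < 2 * r" for a
    unfolding F_def using assms(4) that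
    by (intro merom_at_has_laurent_expansion[OF assms(1,2)]) (auto simp: hL_sections_def)
  have G: "(\<lambda>w. s' (x + w) a) has_laurent_expansion G a" if "a < 2 * r" for a
    unfolding G_def using assms(5) that
    by (intro merom_at_has_laurent_expansion[OF assms(1,2)]) (auto simp: hL_sections_def)
  \<comment> \<open>A common bound for all pole orders and for the legs in \<open>S\<close>;
    \<open>Suc\<close> makes the bound on the legs strict.\<close>
  have "finite ((\<lambda>a. nat (- fls_subdegree (F a))) ` {..<2 * r}
      \<union> (\<lambda>a. nat (- fls_subdegree (G a))) ` {..<2 * r} \<union> Suc ` snd ` S)" (is "finite ?B")
    using assms(3) by simp
  then obtain M where M: "\<forall>n\<in>?B. n \<le> M"
    unfolding finite_nat_set_iff_bounded_le by (elim exE)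
  have MF: "- int M \<le> fls_subdegree (F a)" and MG: "- int M \<le> fls_subdegree (G a)"
    if "a < 2 * r" for a
  proof -
    have "nat (- fls_subdegree (F a)) \<le> M" "nat (- fls_subdegree (G a)) \<le> M"
      using M that by auto
    then show "- int M \<le> fls_subdegree (F a)" "- int M \<le> fls_subdegree (G a)" by linarith+
  qed
  have MS: "snd l < M" if "l \<in> S" for l
  proof -
    have "Suc (snd l) \<in> ?B" using that by blast
    with M have "Suc (snd l) \<le> M" by blast
    then show ?thesis by simp
  qed
  let ?N = "{..<2 * r} \<times> {..<M}"
  have F0: "fls_nth (F a) (- int n - 1) = 0 \<and> fls_nth (G a) (- int n - 1) = 0"
    if "a < 2 * r" "M \<le> n" for a n
    using MF[of a] MG[of a] that by (intro conjI fls_eq0_below_subdegree) auto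
  have N: "polar_coeff r x s l = 0 \<and> polar_coeff r x s' l = 0
      \<and> (l \<in> S \<longrightarrow> taylor_coeff r x s l = 0 \<and> taylor_coeff r x s' l = 0)" if "l \<notin> ?N" for l
  proof (cases "fst l < 2 * r")
    case True
    with that have "M \<le> snd l" by (cases l) auto
    with True F0 MS[of l] show ?thesis
      unfolding polar_coeff_def F_def G_def by auto
  qed (simp add: polar_coeff_def taylor_coeff_def)
  have "fock_act r x (fock_act r x f (EPart s)) (EPart s') S
       + fock_act r x (fock_act r x f (EPart s')) (EPart s) S
      = (\<Sum>l\<in>?N. polar_coeff r x s l * taylor_coeff r x s' l
          + taylor_coeff r x s l * polar_coeff r x s' l) * f S"
    unfolding fock_act.simps by (rule clifford_act_anticommute[OF assms(3) _ N]) simp_all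
  also have "(\<Sum>l\<in>?N. polar_coeff r x s l * taylor_coeff r x s' l
          + taylor_coeff r x s l * polar_coeff r x s' l)
      = (\<Sum>b<2 * r. \<Sum>n<M. polar_coeff r x s (b, n) * taylor_coeff r x s' (b, n))
      + (\<Sum>b<2 * r. \<Sum>n<M. polar_coeff r x s' (b, n) * taylor_coeff r x s (b, n))"
    by (simp only: sum.distrib sum.cartesian_product' mult.commute[of "taylor_coeff r x s _"])
  also have "(\<Sum>b<2 * r. \<Sum>n<M. polar_coeff r x s (b, n) * taylor_coeff r x s' (b, n))
      = (\<Sum>b<2 * r. \<Sum>a<2 * r. eta r b a * (\<Sum>n<M. fls_nth (F b) (- int n - 1) * fls_nth (G a) (int n)))"
    unfolding F_def G_def by (rule sum_polar_taylor)
  also have "(\<Sum>b<2 * r. \<Sum>n<M. polar_coeff r x s' (b, n) * taylor_coeff r x s (b, n))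
      = (\<Sum>b<2 * r. \<Sum>a<2 * r. eta r b a * (\<Sum>n<M. fls_nth (G b) (- int n - 1) * fls_nth (F a) (int n)))"
    unfolding F_def G_def by (rule sum_polar_taylor)
  \<comment> \<open>Exchanging \<open>a\<close> and \<open>b\<close>, with \<open>eta\<close>
    symmetric, brings the second half under the same outer sums as the first.\<close>
  also have "\<dots> = (\<Sum>b<2 * r. \<Sum>a<2 * r. eta r b a * (\<Sum>n<M. fls_nth (F b) (int n) * fls_nth (G a) (- int n - 1)))"
    by (subst sum.swap) (simp only: eta_commute[of r] mult.commute[of "fls_nth (G _) _"])
  also have "(\<Sum>b<2 * r. \<Sum>a<2 * r. eta r b a * (\<Sum>n<M. fls_nth (F b) (- int n - 1) * fls_nth (G a) (int n)))
      + \<dots> = (\<Sum>b<2 * r. \<Sum>a<2 * r. eta r b a * fls_nth (F b * G a) (-1))"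
    unfolding sum.distrib[symmetric] distrib_left[symmetric]
    using MF MG by (intro sum.cong refl arg_cong[where f = "(*) _"] fls_residue_mult[symmetric]) auto
  also have "\<dots> = fls_nth (\<Sum>b<2 * r. \<Sum>a<2 * r. fls_const (eta r b a) * F b * G a) (-1)"
    by (simp add: fls_nth_sum mult.assoc)
  also have "(\<Sum>b<2 * r. \<Sum>a<2 * r. fls_const (eta r b a) * F b * G a)
      = laurent_expansion (\<lambda>t. \<Sum>a<2 * r. \<Sum>b<2 * r. eta r a b * s t a * s' t b) x"
    by (rule laurent_expansion_eqI[symmetric])
       (intro has_laurent_expansion_sum has_laurent_expansion_mult has_laurent_expansion_cmult_left F G; simp)
  finally show ?thesis by simp
qed

text \<open>Only finite sets enter the hypothesis, because the bracket relation is established only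
  there; flipping a leg preserves finiteness.\<close>

lemma fock_act_lin:
  assumes "\<And>S. finite S \<Longrightarrow> h S = c * f S + g S" "finite S"
  shows "fock_act r x h l S = c * fock_act r x f l S + fock_act r x g l S"
proof (cases l)
  case (EPart s)
  show ?thesis
    using assms unfolding EPart fock_act.simps clifford_act_def
    by (simp add: sum_distrib_left algebra_simps flip: sum.distrib)
next
  case (OmPart w)
  then show ?thesis using assms by (simp add: algebra_simps)
qed

lemma foldl_fock_act_lin:
  assumes "\<And>S. finite S \<Longrightarrow> h S = c * f S + g S" "finite S"
  shows "foldl (fock_act r x) h v S = c * foldl (fock_act r x) f v S + foldl (fock_act r x) g v S"
  using assms
proof (induction v arbitrary: h f g)
  case (Cons l v)
  show ?case
    using Cons.prems by (simp, intro Cons.IH fock_act_lin) auto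
qed simp

lemma foldl_fock_act_zero:
  assumes "\<And>S. finite S \<Longrightarrow> h S = 0" "finite S"
  shows "foldl (fock_act r x) h v S = 0"
  \<comment> \<open>With all three functionals equal, linearity reads
    \<open>y = y + y\<close>.\<close>
  using foldl_fock_act_lin[of h 1 h h S r x v] assms by simp

text \<open>The three sums have different supports, so they are compared over one finite set: the
  polar supports together with \<open>S\<close>, where Taylor coefficients enter.\<close>

lemma fock_act_E_lin:
  assumes "open D" "x \<in> D" "finite S"
    and "EPart s \<in> hL_sections r D x" "EPart s' \<in> hL_sections r D x"
    and "\<forall>t\<in>D - {x}. \<forall>a<2 * r. s'' t a = c * s t a + s' t a"
  shows "fock_act r x f (EPart s'') S = c * fock_act r x f (EPart s) S + fock_act r x f (EPart s') S"
proof -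
  have lin: "fls_nth (laurent_expansion (\<lambda>t. s'' t a) x) n
      = c * fls_nth (laurent_expansion (\<lambda>t. s t a) x) n + fls_nth (laurent_expansion (\<lambda>t. s' t a) x) n"
    if "a < 2 * r" for a n
    using assms that by (intro laurent_expansion_lin[OF assms(1,2)]) (auto simp: hL_sections_def)
  have P: "polar_coeff r x s'' l = c * polar_coeff r x s l + polar_coeff r x s' l" for l
    by (simp add: polar_coeff_def lin add_divide_distrib)
  have Q: "taylor_coeff r x s'' l = c * taylor_coeff r x s l + taylor_coeff r x s' l" for l
    by (simp add: taylor_coeff_def lin algebra_simps sum.distrib sum_distrib_left)
  have fin: "finite {l. polar_coeff r x s l \<noteq> 0}" if "EPart s \<in> hL_sections r D x" for s
  proof (rule finite_subset)
    show "{l. polar_coeff r x s l \<noteq> 0} \<subseteq> (SIGMA a:{..<2 * r}.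
        {..<nat (- fls_subdegree (laurent_expansion (\<lambda>t. s t a) x))})"
    proof
      fix l assume "l \<in> {l. polar_coeff r x s l \<noteq> 0}"
      then have l: "fst l < 2 * r"
        "fls_nth (laurent_expansion (\<lambda>t. s t (fst l)) x) (- int (snd l) - 1) \<noteq> 0"
        by (auto simp: polar_coeff_def split: if_splits)
      then have "fls_subdegree (laurent_expansion (\<lambda>t. s t (fst l)) x) \<le> - int (snd l) - 1"
        by (intro fls_subdegree_leI)
      with l show "l \<in> (SIGMA a:{..<2 * r}.
        {..<nat (- fls_subdegree (laurent_expansion (\<lambda>t. s t a) x))})"
        by (cases l) auto
    qed
  qed simp
  let ?N = "{l. polar_coeff r x s l \<noteq> 0} \<union> {l. polar_coeff r x s' l \<noteq> 0} \<union> S"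
  have N: "finite ?N" using fin assms by auto
  have "clifford_act (polar_coeff r x s'') (taylor_coeff r x s'') f S
      = (\<Sum>l\<in>?N. (if l \<in> S then taylor_coeff r x s'' l else polar_coeff r x s'' l)
          * shuffle_sign {l} (S - {l}) * f (toggle l S))"
    by (rule clifford_act_eq[OF N]) (auto simp: P)
  moreover have "clifford_act (polar_coeff r x s) (taylor_coeff r x s) f S
      = (\<Sum>l\<in>?N. (if l \<in> S then taylor_coeff r x s l else polar_coeff r x s l)
          * shuffle_sign {l} (S - {l}) * f (toggle l S))"
    by (rule clifford_act_eq[OF N]) auto
  moreover have "clifford_act (polar_coeff r x s') (taylor_coeff r x s') f S
      = (\<Sum>l\<in>?N. (if l \<in> S then taylor_coeff r x s' l else polar_coeff r x s' l)
          * shuffle_sign {l} (S - {l}) * f (toggle l S))"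
    by (rule clifford_act_eq[OF N]) auto
  moreover have "(if l \<in> S then taylor_coeff r x s'' l else polar_coeff r x s'' l)
      * shuffle_sign {l} (S - {l}) * f (toggle l S)
      = c * ((if l \<in> S then taylor_coeff r x s l else polar_coeff r x s l)
          * shuffle_sign {l} (S - {l}) * f (toggle l S))
      + (if l \<in> S then taylor_coeff r x s' l else polar_coeff r x s' l)
          * shuffle_sign {l} (S - {l}) * f (toggle l S)" for l
    by (simp add: P Q algebra_simps)
  ultimately show ?thesis
    by (simp add: sum.distrib sum_distrib_left)
qed

text \<open>A pure pole has no Taylor part, and its factorial cancels the one in
  \<open>polar_coeff\<close>, so the operator is the transpose of exterior multiplication by a
  single leg.\<close>

lemma fock_act_creation:
  assumes "fst l < 2 * r" "finite S"
  shows "fock_act r x f (creation x l) S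
    = (if l \<in> S then 0 else shuffle_sign {l} S * f (insert l S))"
proof -
  define s where "s = (\<lambda>t b. if b = fst l then fact (snd l) / (t - x) ^ (snd l + 1) else 0)"
  have L: "laurent_expansion (\<lambda>t. s t b) x
      = (if b = fst l then fls_const (fact (snd l)) * fls_X_intpow (- int (snd l + 1)) else 0)" for b
    using laurent_expansion_pole[of "fact (snd l)" x "snd l + 1"]
      laurent_expansion_eqI[OF has_laurent_expansion_0, of x]
    by (cases "b = fst l") (simp_all add: s_def)
  have P: "polar_coeff r x s m = (if m = l then 1 else 0)" for m
    using assms(1) by (cases m; cases l) (auto simp: polar_coeff_def L)
  have Q: "taylor_coeff r x s m = 0" for m
    by (auto simp: taylor_coeff_def L intro!: sum.neutral)
  have "fock_act r x f (EPart s) S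
      = (\<Sum>m\<in>{l}. (if m \<in> S then taylor_coeff r x s m else polar_coeff r x s m)
          * shuffle_sign {m} (S - {m}) * f (toggle m S))"
    unfolding fock_act.simps by (rule clifford_act_eq) (auto simp: P Q)
  then show ?thesis
    by (simp add: creation_def s_def[symmetric] P Q toggle_def)
qed

text \<open>The recursion is that of \<open>wedge_legs_Cons\<close>; \<open>f\<close> is generalised
  because the first letter changes the functional.\<close>

lemma foldl_fock_act_creation:
  assumes "\<forall>l\<in>set ls. fst l < 2 * r"
  shows "foldl (fock_act r x) f (map (creation x) ls) {} = wedge_legs ls (set ls) * f (set ls)"
  using assms
proof (induction ls arbitrary: f)
  case (Cons l ls)
  show ?case
  proof (cases "l \<in> set ls")
    case True
    then have "wedge_legs (l # ls) (set (l # ls)) = 0" by (simp add: wedge_legs_def)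
    with True Cons show ?thesis by (simp add: fock_act_creation)
  next
    case False
    with Cons show ?thesis by (simp add: fock_act_creation wedge_legs_Cons)
  qed
qed (simp add: wedge_legs_Nil)

section \<open>Functionals annihilating the vacuum relations\<close>

definition fock_functional :: "nat \<Rightarrow> complex \<Rightarrow> (leg set \<Rightarrow> complex) \<Rightarrow> free_alg \<Rightarrow> complex" where
  "fock_functional r x f A = (\<Sum>v | A v \<noteq> 0. A v * foldl (fock_act r x) f v {})"

lemma fock_functional_eq:
  assumes "finite V" "{v. A v \<noteq> 0} \<subseteq> V"
  shows "fock_functional r x f A = (\<Sum>v\<in>V. A v * foldl (fock_act r x) f v {})"
  unfolding fock_functional_def using assms by (intro sum.mono_neutral_left) auto

text \<open>Finiteness of supports is carried along because \<open>free_alg\<close> admits arbitrary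
  functions, and a sum over an infinite support is 0 by convention, which would break
  additivity.\<close>

lemma fock_functional_lin:
  assumes "finite {v. A v \<noteq> 0}" "finite {v. B v \<noteq> 0}"
  shows "finite {v. c * A v + B v \<noteq> 0}"
    and "fock_functional r x f (\<lambda>v. c * A v + B v) = c * fock_functional r x f A + fock_functional r x f B"
proof -
  let ?V = "{v. A v \<noteq> 0} \<union> {v. B v \<noteq> 0}"
  have V: "finite ?V" using assms by simp
  show "finite {v. c * A v + B v \<noteq> 0}"
    by (rule finite_subset[OF _ V]) auto
  have "fock_functional r x f (\<lambda>v. c * A v + B v) = (\<Sum>v\<in>?V. (c * A v + B v) * foldl (fock_act r x) f v {})"
    by (rule fock_functional_eq[OF V]) auto
  moreover have "fock_functional r x f A = (\<Sum>v\<in>?V. A v * foldl (fock_act r x) f v {})"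
    by (rule fock_functional_eq[OF V]) auto
  moreover have "fock_functional r x f B = (\<Sum>v\<in>?V. B v * foldl (fock_act r x) f v {})"
    by (rule fock_functional_eq[OF V]) auto
  ultimately show "fock_functional r x f (\<lambda>v. c * A v + B v) = c * fock_functional r x f A + fock_functional r x f B"
    by (simp add: algebra_simps sum.distrib sum_distrib_left)
qed

lemma word_support [simp]: "{u. word v u \<noteq> 0} = {v}"
  by (auto simp: word_def)

lemma fock_functional_word: "fock_functional r x f (word v) = foldl (fock_act r x) f v {}"
  unfolding fock_functional_def word_support by (simp add: word_def)

text \<open>The common shape of the linearity relations and, with \<open>c = -1\<close>, of the
  bracket relation.\<close>

lemma fock_functional_words:
  "finite {y. word v y - c * word v' y - word v'' y \<noteq> 0}"
  "fock_functional r x f (\<lambda>y. word v y - c * word v' y - word v'' y)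
    = foldl (fock_act r x) f v {} - c * foldl (fock_act r x) f v' {} - foldl (fock_act r x) f v'' {}"
proof -
  note 1 = fock_functional_lin[where A = "word v''" and B = "word v" and c = "-1"]
  note 2 = fock_functional_lin[where A = "word v'" and B = "\<lambda>y. (-1) * word v'' y + word v y" and c = "-c"]
  have eq: "(\<lambda>y. word v y - c * word v' y - word v'' y)
      = (\<lambda>y. (- c) * word v' y + ((-1) * word v'' y + word v y))"
    by (simp add: algebra_simps fun_eq_iff)
  have f1: "finite {y. (-1) * word v'' y + word v y \<noteq> 0}"
    by (rule 1(1)) simp_all
  have "finite {y. (- c) * word v' y + ((-1) * word v'' y + word v y) \<noteq> 0}"
    using f1 by (intro 2(1)) simp_all
  then show "finite {y. word v y - c * word v' y - word v'' y \<noteq> 0}"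
    by (simp add: algebra_simps)
  have "fock_functional r x f (\<lambda>y. (- c) * word v' y + ((-1) * word v'' y + word v y))
      = (- c) * fock_functional r x f (word v') + fock_functional r x f (\<lambda>y. (-1) * word v'' y + word v y)"
    using f1 by (intro 2(2)) simp_all
  also have "fock_functional r x f (\<lambda>y. (-1) * word v'' y + word v y)
      = (-1) * fock_functional r x f (word v'') + fock_functional r x f (word v)"
    by (intro 1(2)) simp_all
  finally show "fock_functional r x f (\<lambda>y. word v y - c * word v' y - word v'' y)
    = foldl (fock_act r x) f v {} - c * foldl (fock_act r x) f v' {} - foldl (fock_act r x) f v'' {}"
    unfolding eq by (simp add: fock_functional_word)
qed

text \<open>A prefix \<open>u\<close> only changes the functional and a suffix \<open>v\<close>
  preserves linear identities, so each relation reduces to one between operators. The vacuum clauses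
  hold because evaluation at \<open>{}\<close> sees only polar parts and residues.\<close>

lemma fock_functional_vac_rels:
  assumes "open D" "x \<in> D" "A \<in> vac_rels r D x"
  shows "finite {v. A v \<noteq> 0} \<and> fock_functional r x f A = 0"
  using assms(3)
proof induction
  case (E_lin u v s s' s'' c)
  have "foldl (fock_act r x) f (u @ [EPart s''] @ v) {}
      = c * foldl (fock_act r x) f (u @ [EPart s] @ v) {} + foldl (fock_act r x) f (u @ [EPart s'] @ v) {}"
    unfolding foldl_append foldl.simps using E_lin
    by (intro foldl_fock_act_lin fock_act_E_lin[OF assms(1,2)]) simp_all
  then show ?case by (simp only: fock_functional_words) simp
next
  case (Om_lin u v w w' w'' c)
  have "fls_nth (laurent_expansion w'' x) (-1)
      = c * fls_nth (laurent_expansion w x) (-1) + fls_nth (laurent_expansion w' x) (-1)"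
    using Om_lin by (intro laurent_expansion_lin[OF assms(1,2)]) (auto simp: hL_sections_def)
  then have "foldl (fock_act r x) f (u @ [OmPart w''] @ v) {}
      = c * foldl (fock_act r x) f (u @ [OmPart w] @ v) {} + foldl (fock_act r x) f (u @ [OmPart w'] @ v) {}"
    unfolding foldl_append by (simp, intro foldl_fock_act_lin) (auto simp: algebra_simps)
  then show ?case by (simp only: fock_functional_words) simp
next
  case (exact u v g)
  have "foldl (fock_act r x) f (u @ [OmPart (deriv g)] @ v) {} = 0"
    unfolding foldl_append using laurent_expansion_deriv_residue[OF assms(1,2) exact(2)]
    by (simp, intro foldl_fock_act_zero) auto
  then show ?case by (simp add: fock_functional_word)
next
  case (bracket u v s s')
  have "foldl (fock_act r x) f (u @ [EPart s, EPart s'] @ v) {}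
      = (-1) * foldl (fock_act r x) f (u @ [EPart s', EPart s] @ v) {}
      + foldl (fock_act r x) f (u @ [OmPart (\<lambda>t. \<Sum>a<2 * r. \<Sum>b<2 * r. eta r a b * s t a * s' t b)] @ v) {}"
    unfolding foldl_append
  proof (simp only: foldl.simps, rule foldl_fock_act_lin)
    fix S :: "leg set" assume "finite S"
    then show "fock_act r x (fock_act r x (foldl (fock_act r x) f u) (EPart s)) (EPart s') S
        = -1 * fock_act r x (fock_act r x (foldl (fock_act r x) f u) (EPart s')) (EPart s) S
        + fock_act r x (foldl (fock_act r x) f u)
            (OmPart (\<lambda>t. \<Sum>a<2 * r. \<Sum>b<2 * r. eta r a b * s t a * s' t b)) S"
      using fock_act_bracket[OF assms(1,2), of S s r s' "foldl (fock_act r x) f u"] bracket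
      by (simp add: eq_diff_eq)
  qed simp
  then have "fock_functional r x f (\<lambda>y. word (u @ [EPart s, EPart s'] @ v) y - (-1) * word (u @ [EPart s', EPart s] @ v) y
         - word (u @ [OmPart (\<lambda>t. \<Sum>a<2 * r. \<Sum>b<2 * r. eta r a b * s t a * s' t b)] @ v) y) = 0"
    unfolding fock_functional_words by simp
  moreover have "finite {y. word (u @ [EPart s, EPart s'] @ v) y - (-1) * word (u @ [EPart s', EPart s] @ v) y
         - word (u @ [OmPart (\<lambda>t. \<Sum>a<2 * r. \<Sum>b<2 * r. eta r a b * s t a * s' t b)] @ v) y \<noteq> 0}"
    by (rule fock_functional_words)
  ultimately show ?case by simp
next
  case (central u v w l)
  \<comment> \<open>A scalar passes through the operator of \<open>l\<close> by linearity with zero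
    second summand; the zero functional is sent to zero because its image satisfies
    \<open>y = y + y\<close>.\<close>
  have comm: "fock_act r x (fock_act r x g (OmPart w)) l S = fock_act r x (fock_act r x g l) (OmPart w) S"
    if "finite S" for g S
    using fock_act_lin[of "\<lambda>S. fls_nth (laurent_expansion w x) (-1) * g S"
      "fls_nth (laurent_expansion w x) (-1)" g "\<lambda>_. 0" S r x l]
      fock_act_lin[of "\<lambda>_. 0" 1 "\<lambda>_. 0" "\<lambda>_. 0" S r x l] that by simp
  have "foldl (fock_act r x) f (u @ [OmPart w, l] @ v) {}
      = 1 * foldl (fock_act r x) f (u @ [l, OmPart w] @ v) {} + foldl (fock_act r x) (\<lambda>_. 0) v {}"
    unfolding foldl_append
    by (simp only: foldl.simps, rule foldl_fock_act_lin) (simp_all add: comm del: fock_act.simps)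
  moreover have "foldl (fock_act r x) (\<lambda>_. 0) v {} = 0"
    by (rule foldl_fock_act_zero) auto
  moreover have "finite {y. (-1) * word (u @ [l, OmPart w] @ v) y + word (u @ [OmPart w, l] @ v) y \<noteq> 0}"
      "fock_functional r x f (\<lambda>y. (-1) * word (u @ [l, OmPart w] @ v) y + word (u @ [OmPart w, l] @ v) y)
      = (-1) * fock_functional r x f (word (u @ [l, OmPart w] @ v)) + fock_functional r x f (word (u @ [OmPart w, l] @ v))"
    by (intro fock_functional_lin; simp)+
  ultimately show ?case by (simp add: fock_functional_word)
next
  case (unit u v)
  have "fls_nth (laurent_expansion (\<lambda>t. 1 / (t - x)) x) (-1) = 1"
    using laurent_expansion_pole[of 1 x 1] by simp
  then have "foldl (fock_act r x) f (u @ [OmPart (\<lambda>t. 1 / (t - x))] @ v) {} = foldl (fock_act r x) f (u @ v) {}"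
    by simp
  moreover have "finite {y. (-1) * word (u @ v) y + word (u @ [OmPart (\<lambda>t. 1 / (t - x))] @ v) y \<noteq> 0}"
      "fock_functional r x f (\<lambda>y. (-1) * word (u @ v) y + word (u @ [OmPart (\<lambda>t. 1 / (t - x))] @ v) y)
      = (-1) * fock_functional r x f (word (u @ v)) + fock_functional r x f (word (u @ [OmPart (\<lambda>t. 1 / (t - x))] @ v))"
    by (intro fock_functional_lin; simp)+
  ultimately show ?case by (simp add: fock_functional_word)
next
  case (vacuum_E u s)
  have "polar_coeff r x s l = 0" for l
    using vacuum_E(2) laurent_expansion_holomorphic_neg[OF assms(1,2), of "\<lambda>t. s t (fst l)" "- int (snd l) - 1"]
    by (auto simp: polar_coeff_def)
  then have "foldl (fock_act r x) f (u @ [EPart s]) {} = 0"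
    by (simp add: clifford_act_def)
  then show ?case by (simp add: fock_functional_word)
next
  case (vacuum_Om u w)
  have "foldl (fock_act r x) f (u @ [OmPart w]) {} = 0"
    using laurent_expansion_holomorphic_neg[OF assms(1,2) vacuum_Om(2), of "-1"] by simp
  then show ?case by (simp add: fock_functional_word)
next
  case (add A B)
  then show ?case using fock_functional_lin(1)[where A = A and B = B and c = 1]
      fock_functional_lin(2)[where A = A and B = B and c = 1] by simp
next
  case (scale A c)
  then show ?case using fock_functional_lin(1)[where A = A and B = "\<lambda>_. 0" and c = c]
      fock_functional_lin(2)[where A = A and B = "\<lambda>_. 0" and c = c] by (simp add: fock_functional_def)
qed

section \<open>Well-definedness of \<open>tau\<close> and the local product\<close>

lemma vac_rels_zero: "(\<lambda>_. 0) \<in> vac_rels r D x"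
proof -
  have "word ([] @ [OmPart (\<lambda>_. 0)]) \<in> vac_rels r D x"
    by (rule vac_rels.vacuum_Om) auto
  from vac_rels.scale[OF this, of 0] show ?thesis by simp
qed

text \<open>The functional dual to the basis element of \<open>S\<close> reads off one coordinate of
  \<open>w\<close> from the representative. Vanishing outside \<open>D\<close> is recorded because
  equality of whole functions is wanted later.\<close>

lemma tau_graph_fock_functional:
  assumes "tau_graph r D A w"
  shows "finite {v. A q x v \<noteq> 0} \<and>
    (x \<in> D \<longrightarrow> fock_functional r x (\<lambda>T. if T = S then 1 else 0) (A q x) = w q S x) \<and>
    (x \<notin> D \<longrightarrow> w q S x = 0)"
  using assms
proof induction
  case (1 g p ls)
  let ?c = "if q = p then g x else 0"
  have eq: "cl_term ls p g q x = (\<lambda>v. ?c * word (map (creation x) ls) v + 0)"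
    by (auto simp: cl_term_def)
  have "finite {v. cl_term ls p g q x v \<noteq> 0}"
    unfolding eq by (rule fock_functional_lin(1)) simp_all
  moreover have "fock_functional r x (\<lambda>T. if T = S then 1 else 0) (cl_term ls p g q x)
      = ?c * fock_functional r x (\<lambda>T. if T = S then 1 else 0) (word (map (creation x) ls))
      + fock_functional r x (\<lambda>T. if T = S then 1 else 0) (\<lambda>_. 0)"
    unfolding eq by (rule fock_functional_lin(2)) simp_all
  moreover have "fock_functional r x (\<lambda>T. if T = S then 1 else 0) (\<lambda>_. 0) = 0"
    by (simp add: fock_functional_def)
  moreover have "fock_functional r x (\<lambda>T. if T = S then 1 else 0) (word (map (creation x) ls))
      = wedge_legs ls S"
    using 1 wedge_legs_eq_0[of S ls] by (simp add: fock_functional_word foldl_fock_act_creation)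
  ultimately show ?case by (simp add: ext_term_def)
next
  case (2 A w B w')
  then show ?case
    using fock_functional_lin(1)[where A = "A q x" and B = "B q x" and c = 1]
      fock_functional_lin(2)[where A = "A q x" and B = "B q x" and c = 1] by simp
qed

text \<open>Representatives of one class differ by a relation, on which the coordinate functionals
  vanish. This gives the uniqueness behind the definite description in \<open>tau\<close>.\<close>

lemma tau_graph_unique:
  assumes "open D" "tau_graph r D A w" "tau_graph r D B w'" "cl_class r D A = cl_class r D B"
  shows "w = w'"
proof (intro ext)
  fix q S x
  show "w q S x = w' q S x"
  proof (cases "x \<in> D")
    case True
    let ?\<phi> = "fock_functional r x (\<lambda>T. if T = S then 1 else 0)"
    have "A q x \<in> cl_class r D A q x"
      using True vac_rels_zero by (simp add: cl_class_def)
    then have "A q x \<in> cl_class r D B q x" using assms(4) by simp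
    then have rel: "(\<lambda>y. A q x y - B q x y) \<in> vac_rels r D x"
      using True by (simp add: cl_class_def)
    note A = tau_graph_fock_functional[OF assms(2), of q x S]
    note B = tau_graph_fock_functional[OF assms(3), of q x S]
    have "?\<phi> (\<lambda>y. (-1) * B q x y + A q x y) = (-1) * ?\<phi> (B q x) + ?\<phi> (A q x)"
      using A B by (intro fock_functional_lin(2)) auto
    moreover have "?\<phi> (\<lambda>y. (-1) * B q x y + A q x y) = 0"
      using fock_functional_vac_rels[OF assms(1) True rel] by simp
    ultimately show ?thesis using A B True by simp
  next
    case False
    then show ?thesis
      using tau_graph_fock_functional[OF assms(2), of q x S]
        tau_graph_fock_functional[OF assms(3), of q x S] by simp
  qed
qed

lemma tau_eq:
  assumes "open (chart_img X i)" "tau_graph (bdl_rank X) (chart_img X i) A w"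
  shows "tau X i (cl_class (bdl_rank X) (chart_img X i) A) = w"
  unfolding tau_def
proof (rule the_equality)
  show "\<exists>B. tau_graph (bdl_rank X) (chart_img X i) B w \<and>
      cl_class (bdl_rank X) (chart_img X i) A = cl_class (bdl_rank X) (chart_img X i) B"
    using assms(2) by blast
qed (use assms tau_graph_unique in blast)

text \<open>On the range of \<open>tau\<close>, \<open>inv_into\<close> is a right inverse, and
  \<open>tau_graph_ext_wedge\<close> puts the wedge product into that range.\<close>

lemma tau_local_product:
  assumes "open (chart_img X i)"
    and "tau_graph (bdl_rank X) (chart_img X i) A w" "a = cl_class (bdl_rank X) (chart_img X i) A"
    and "tau_graph (bdl_rank X) (chart_img X i) B w'" "b = cl_class (bdl_rank X) (chart_img X i) B"
  shows "tau X i (local_product X i a b) = ext_wedge w w'"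
proof -
  obtain C where C: "tau_graph (bdl_rank X) (chart_img X i) C (ext_wedge w w')"
    using tau_graph_ext_wedge[OF assms(1,2,4)] by blast
  then have "ext_wedge w w' = tau X i (cl_class (bdl_rank X) (chart_img X i) C)"
    using tau_eq[OF assms(1)] by simp
  then have "ext_wedge w w' \<in> tau X i ` chiral_clifford X i"
    using tau_graph_cl_reps[OF C] by (auto simp: chiral_clifford_def)
  then show ?thesis
    using assms by (simp add: local_product_def tau_eq f_inv_into_f)
qed

section \<open>Super-cyclicity\<close>

text \<open>A nonzero \<open>c\<close> leaves unchanged the index set of the sum, which is cut out
  by nonvanishing of \<open>w\<close>.\<close>

lemma exp_contraction_scale:
  assumes "c \<noteq> 0"
  shows "exp_contraction r K (\<lambda>q S x. c * w q S x) = (\<lambda>q R x. c * exp_contraction r K w q R x)"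
  using assms by (simp add: exp_contraction_def sum_distrib_left mult_ac fun_eq_iff)

text \<open>The cover is chosen independently of the form, and a scalar comes out of the integral
  even without integrability, where the value is 0 by convention.\<close>

lemma surface_integral_scale:
  "surface_integral X (\<lambda>i x. c * \<mu> i x) = c * surface_integral X \<mu>"
  by (simp add: surface_integral_def Let_def sum_distrib_left mult_ac set_lebesgue_integral_def)

lemma tr_omega_scale: "tr_omega X i (\<lambda>q x. c * f q x) = c * tr_omega X i f"
  unfolding tr_omega_def surface_integral_scale[symmetric]
  by (rule arg_cong[where f = "surface_integral X"]) (auto simp: fun_eq_iff)

theorem lemma7p15:
  fixes X :: "('i, 'x::t2_space) framed_surface"
    and h :: "'i \<Rightarrow> 'x \<Rightarrow> nat \<Rightarrow> nat \<Rightarrow> complex"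
    and \<nu> :: "'i \<Rightarrow> 'x \<Rightarrow> real"
    and P :: "('i, 'x) E_kernel"
    and U :: 'i
    and a b :: cl_section
    and deg_a deg_b :: nat
  assumes "compact_riemann_surface X"
    and "holomorphic_bundle X"
    and "hermitian_metric X h"
    and "surface_metric X \<nu>"
    and "szego_kernel X h \<nu> P"
    and "coordinate_disc X U"
    and "deg_a \<in> {0, 1}" and "deg_b \<in> {0, 1}"
    and "a \<in> chiral_clifford_hom X U deg_a"
    and "b \<in> chiral_clifford_hom X U deg_b"
    and "tr_applicable X U (proj_omega (W_ch X P U (local_product X U a b)))"
  shows "tr_omega X U (proj_omega (W_ch X P U (local_product X U a b)))
       = (-1) ^ (deg_a * deg_b) * tr_omega X U (proj_omega (W_ch X P U (local_product X U b a)))"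
proof -
  have op: "open (chart_img X U)"
    using assms(6) by (auto simp: coordinate_disc_def)
  obtain A w where A: "tau_graph (bdl_rank X) (chart_img X U) A w" "ext_homogeneous deg_a w"
      "a = cl_class (bdl_rank X) (chart_img X U) A"
    using assms(9) cl_reps_tau_graph unfolding chiral_clifford_hom_def by blast
  obtain B w' where B: "tau_graph (bdl_rank X) (chart_img X U) B w'" "ext_homogeneous deg_b w'"
      "b = cl_class (bdl_rank X) (chart_img X U) B"
    using assms(10) cl_reps_tau_graph unfolding chiral_clifford_hom_def by blast
  have "tau X U (local_product X U a b)
      = (\<lambda>n S x. (-1) ^ (deg_a * deg_b) * tau X U (local_product X U b a) n S x)"
    unfolding tau_local_product[OF op A(1,3) B(1,3)] tau_local_product[OF op B(1,3) A(1,3)]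
    by (rule ext_wedge_supercommute[OF A(2) B(2)])
  \<comment> \<open>The sign is nonzero, so it passes through the contraction operator.\<close>
  then have "proj_omega (W_ch X P U (local_product X U a b))
      = (\<lambda>q x. (-1) ^ (deg_a * deg_b) * proj_omega (W_ch X P U (local_product X U b a)) q x)"
    by (simp add: W_ch_def exp_contraction_scale proj_omega_def)
  then show ?thesis by (simp add: tr_omega_scale)
qed

end
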